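(* Let $a_1,a_2,a_3$ be three different points of $\mathbb{CP}^1$. The complete Kähler-Einstein metric on $\mathbb{CP}^1\setminus\{a_1,a_2,a_3\}$ at the cusp $a_1$ has the asymptotic expansion $$|ds|=\frac{|a_2-a_3|}{16|a_1-a_3||a_2-a_1|}\,\frac{1}{|\mathfrak{f}|\,\bigl|\log|\mathfrak{f}|\bigr|}\left|1-8\left[\left(2\frac{a_2-a_1}{a_2-a_3}-1\right)\mathfrak{f}-\frac{\operatorname{Re}\left(\left(2\frac{a_2-a_1}{a_2-a_3}-1\right)\mathfrak{f}\right)}{\log|\mathfrak{f}|}\right]+O(\mathfrak{f}^2)\right||df|$$ in $$\mathfrak{f}=\frac{a_2-a_3}{16(a_1-a_3)(a_2-a_1)}(f-a_1),$$ where $f$ denotes the coordinate of a point of $\mathbb{CP}^1\setminus\{a_1,a_2,a_3\}$.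
   Context: The complete Kähler-Einstein metric on $\mathbb{CP}^1\setminus\{a_1,a_2,a_3\}$ is the one induced through the universal covering map $\mathbb{H}\to\mathbb{CP}^1\setminus\{a_1,a_2,a_3\}$ from the Poincaré metric $ds^2=\frac{-4}{(\tau-\bar\tau)^2}|d\tau|^2=\frac{|d\tau|^2}{(\operatorname{Im}\tau)^2}$ on the upper half plane $\mathbb{H}$. The formulas are read in the affine coordinate, with the $a_j$ as complex numbers. *)

theory Defs
  imports "HOL-Complex_Analysis.Complex_Analysis"
begin

text \<open>The complex projective line: nonzero vectors of \<open>\<complex> \<times> \<complex>\<close> up to scaling, with the quotient
  topology and the two standard affine charts.\<close>

definition proportional :: "complex \<times> complex \<Rightarrow> complex \<times> complex \<Rightarrow> bool" where
  "proportional x y \<longleftrightarrow> x \<noteq> 0 \<and> y \<noteq> 0 \<and> (\<exists>c. c \<noteq> 0 \<and> y = (c * fst x, c * snd x))"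

lemma proportional_part_equivp: "part_equivp proportional"
proof (rule part_equivpI)
  have "proportional (1, 0) (1, 0)"
    by (auto simp: proportional_def zero_prod_def intro!: exI[of _ 1])
  then show "\<exists>x. proportional x x" by blast
  show "symp proportional"
  proof (rule sympI)
    fix x y assume "proportional x y"
    then obtain c where "x \<noteq> 0" "y \<noteq> 0" "c \<noteq> 0" "y = (c * fst x, c * snd x)"
      by (auto simp: proportional_def)
    then show "proportional y x"
      by (auto simp: proportional_def prod_eq_iff intro!: exI[of _ "inverse c"])
  qed
  show "transp proportional"
  proof (rule transpI)
    fix x y z assume "proportional x y" "proportional y z"
    then obtain c d where "x \<noteq> 0" "z \<noteq> 0" "c \<noteq> 0" "d \<noteq> 0"
        "y = (c * fst x, c * snd x)" "z = (d * fst y, d * snd y)"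
      by (auto simp: proportional_def)
    then show "proportional x z"
      by (auto simp: proportional_def mult.assoc intro!: exI[of _ "d * c"])
  qed
qed

quotient_type cp1 = "complex \<times> complex" / partial: proportional
  by (rule proportional_part_equivp)

instantiation cp1 :: topological_space
begin

definition open_cp1 :: "cp1 set \<Rightarrow> bool" where
  "open_cp1 U \<longleftrightarrow> open {x. x \<noteq> 0 \<and> abs_cp1 x \<in> U}"

instance
proof
  have "{x :: complex \<times> complex. x \<noteq> 0 \<and> abs_cp1 x \<in> UNIV} = - {0}" by auto
  then show "open (UNIV :: cp1 set)" by (simp add: open_cp1_def open_Compl)
next
  fix S T :: "cp1 set" assume "open S" "open T"
  moreover have "{x. x \<noteq> 0 \<and> abs_cp1 x \<in> S \<inter> T} =
      {x. x \<noteq> 0 \<and> abs_cp1 x \<in> S} \<inter> {x. x \<noteq> 0 \<and> abs_cp1 x \<in> T}" by auto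
  ultimately show "open (S \<inter> T)" by (simp add: open_cp1_def open_Int)
next
  fix K :: "cp1 set set" assume "\<forall>S\<in>K. open S"
  moreover have "{x. x \<noteq> 0 \<and> abs_cp1 x \<in> \<Union>K} = (\<Union>S\<in>K. {x. x \<noteq> 0 \<and> abs_cp1 x \<in> S})" by auto
  ultimately show "open (\<Union>K)" by (simp add: open_cp1_def open_UN)
qed

end

lift_definition affine_point :: "complex \<Rightarrow> cp1" is "\<lambda>z. (z, 1)"
  by (auto simp: proportional_def zero_prod_def intro!: exI[of _ 1])

lift_definition cp1_infinity :: cp1 is "(1, 0)"
  by (auto simp: proportional_def zero_prod_def intro!: exI[of _ 1])

text \<open>The coordinates \<open>[z : w] \<mapsto> z / w\<close> and \<open>[z : w] \<mapsto> w / z\<close>; they are charts away from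
  \<open>[1 : 0]\<close> and \<open>[0 : 1]\<close> respectively, and take the junk value 0 at those points.\<close>

lift_definition affine_coord :: "cp1 \<Rightarrow> complex" is "\<lambda>x. fst x / snd x"
  by (auto simp: proportional_def)

lift_definition infinity_coord :: "cp1 \<Rightarrow> complex" is "\<lambda>x. snd x / fst x"
  by (auto simp: proportional_def)

definition holomorphic_to_cp1 :: "complex set \<Rightarrow> (complex \<Rightarrow> cp1) \<Rightarrow> bool" where
  "holomorphic_to_cp1 S p \<longleftrightarrow> continuous_on S p \<and>
     (\<lambda>\<tau>. affine_coord (p \<tau>)) holomorphic_on {\<tau> \<in> S. p \<tau> \<noteq> cp1_infinity} \<and>
     (\<lambda>\<tau>. infinity_coord (p \<tau>)) holomorphic_on {\<tau> \<in> S. p \<tau> \<noteq> affine_point 0}"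

definition upper_half_plane :: "complex set" where
  "upper_half_plane = {\<tau>. Im \<tau> > 0}"

text \<open>A covering of \<open>S\<close> by the upper half plane is automatically universal, the upper half plane
  being simply connected.\<close>

definition holomorphic_universal_covering :: "(complex \<Rightarrow> cp1) \<Rightarrow> cp1 set \<Rightarrow> bool" where
  "holomorphic_universal_covering p S \<longleftrightarrow>
     covering_space upper_half_plane p S \<and> holomorphic_to_cp1 upper_half_plane p"

text \<open>Length of the tangent vector \<open>w\<close> at \<open>\<tau>\<close> in the Poincare metric
  \<open>|d\<tau>|\<^sup>2 / (Im \<tau>)\<^sup>2\<close>.\<close>

definition poincare_length :: "complex \<Rightarrow> complex \<Rightarrow> real" where
  "poincare_length \<tau> w = norm w / Im \<tau>"

text \<open>The metric induced through a covering \<open>p\<close>, in the affine coordinate: \<open>KE_length p z v\<close> is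
  the length \<open>|ds|\<close> of the tangent vector \<open>v\<close> at the point \<open>z\<close>, that is, the Poincare length
  of any \<open>w\<close> at any \<open>\<tau>\<close> over \<open>z\<close> such that the differential of \<open>p\<close> at \<open>\<tau>\<close> sends \<open>w\<close> to \<open>v\<close>.
  The description is definite only if this length depends neither on \<open>\<tau>\<close> nor on \<open>w\<close>.\<close>

definition KE_length :: "(complex \<Rightarrow> cp1) \<Rightarrow> complex \<Rightarrow> complex \<Rightarrow> real" where
  "KE_length p z v = (THE r. \<exists>\<tau> w. \<tau> \<in> upper_half_plane \<and> p \<tau> = affine_point z \<and>
     deriv (\<lambda>t. affine_coord (p t)) \<tau> * w = v \<and> r = poincare_length \<tau> w)"

definition cusp_coord :: "complex \<Rightarrow> complex \<Rightarrow> complex \<Rightarrow> complex \<Rightarrow> complex" where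
  "cusp_coord a1 a2 a3 f = (a2 - a3) / (16 * (a1 - a3) * (a2 - a1)) * (f - a1)"

end

theory Submission
  imports Defs
begin

text \<open>
  A Moebius transformation moves the punctures to \<open>0, 1, \<infinity>\<close>. By the Schwarz-Pick lemma and
  lifting, the metric induced by any covering of the plane without 0 and 1 is the Kobayashi
  metric, which is determined by the holomorphic discs. The maps \<open>w \<mapsto> w\<^sup>2\<close> and
  \<open>w \<mapsto> 4 w / (1 + w)\<^sup>2\<close> are both unramified double coverings of the plane without
  0 and 1 by the plane without 0, 1 and \<open>-1\<close>, hence pull the metric back to the same metric. This
  Landen-type functional equation relates the density at \<open>z\<close> to that at a point of order
  \<open>z\<^sup>2 / 16\<close>, so that the crude leading behaviour \<open>1 / (|z| |log |z||)\<close> at the cusp, which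
  follows from Schottky's theorem and Harnack's inequality, determines the density, and with it the
  constant 16 and the first-order term.
\<close>


text \<open>Written for heights, the functional equation is \<open>cusp_height z\<close> = (sqrt |1
  - z| / 2) * \<open>cusp_height (Landen z)\<close>, where \<open>Landen z\<close> is asymptotic to
  z^2 / 16. A solution behaving like C - ln |z| must therefore satisfy C = (C + ln 16) / 2, that is
  C = ln 16; this is the origin of the constant. The obstacle is that the a priori estimate only
  says that \<open>cusp_height z\<close> / (- ln |z|) tends to 1, which does not detect an additive
  constant. It suffices because logarithms are compared: the logarithm of the quotient of
  \<open>cusp_height\<close> by an approximate solution tends to 0 at the cusp and changes only by
  O(|z|^2) under z -> \<open>Landen z\<close>, so it is itself O(|z|^2). The Kobayashi description
  is what makes the functional equation accessible: only discs have to be lifted, by holomorphic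
  square roots, and no modular function or explicit covering of the plane without 0 and 1
  enters.\<close>

section \<open>The Schwarz lemma for maps from the disc to a half plane\<close>

text \<open>The Moebius map x -> (x - \<open>g 0\<close>) / (x + \<open>cnj (g 0)\<close>) takes the
  left half plane to the unit disc and \<open>g 0\<close> to 0, so the Schwarz lemma applies to its
  composite \<open>h\<close> with \<open>g\<close>. The bound on \<open>deriv h 0\<close> is the
  first claim; the bound on \<open>h z\<close>, with the imaginary part discarded, is Harnack's
  inequality.\<close>

lemma holomorphic_halfplane_disc:
  fixes g :: "complex \<Rightarrow> complex"
  assumes hol: "g holomorphic_on ball 0 1"
    and neg: "\<And>z. norm z < 1 \<Longrightarrow> Re (g z) < 0"
  shows norm_deriv_halfplane_le: "norm (deriv g 0) \<le> - 2 * Re (g 0)"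
    and Harnack_halfplane: "norm z < 1 \<Longrightarrow> Re (g z) * (1 + norm z) \<le> Re (g 0) * (1 - norm z)"
proof -
  define h where "h = (\<lambda>z. (g z - g 0) / (g z + cnj (g 0)))"
  have g0: "Re (g 0) < 0" using neg[of 0] by simp
  have nz: "g z + cnj (g 0) \<noteq> 0" if "norm z < 1" for z
  proof
    assume "g z + cnj (g 0) = 0"
    then have "Re (g z + cnj (g 0)) = 0" by simp
    with neg[OF that] g0 show False by simp
  qed
  have holh: "h holomorphic_on ball 0 1"
    unfolding h_def by (intro holomorphic_intros hol) (auto simp: nz)
  have h0: "h 0 = 0" by (simp add: h_def)
  have hlt: "norm (h z) < 1" if "norm z < 1" for z
  proof -
    have "0 < 4 * (Re (g z) * Re (g 0))"
      using mult_neg_neg[OF neg[OF that] g0] by simp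
    also have "\<dots> = (norm (g z + cnj (g 0)))\<^sup>2 - (norm (g z - g 0))\<^sup>2"
      unfolding cmod_power2 by (simp add: power2_eq_square algebra_simps)
    finally have "norm (g z - g 0) < norm (g z + cnj (g 0))"
      by (simp add: power2_less_imp_less)
    then show ?thesis using nz[OF that] by (simp add: h_def norm_divide)
  qed
  note schwarz = Schwarz_Lemma[OF holh h0 hlt]
  have dg: "(g has_field_derivative deriv g 0) (at 0)"
    using hol by (intro holomorphic_derivI[of _ "ball 0 1"]) auto
  have eq: "g 0 + cnj (g 0) = of_real (2 * Re (g 0))" by (simp add: complex_add_cnj)
  have "((\<lambda>z. g z + cnj (g 0)) has_field_derivative deriv g 0) (at 0)"
    and "((\<lambda>z. g z - g 0) has_field_derivative deriv g 0) (at 0)"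
    by (auto intro!: derivative_eq_intros dg)
  from DERIV_divide[OF this(2,1)]
  have "(h has_field_derivative deriv g 0 / (g 0 + cnj (g 0))) (at 0)"
    unfolding h_def using nz[of 0] by simp
  then have "deriv h 0 = deriv g 0 / (g 0 + cnj (g 0))" by (rule DERIV_imp_deriv)
  then have "norm (deriv g 0) / (- 2 * Re (g 0)) \<le> 1"
    using schwarz(2)[of 0] g0 unfolding eq by (simp add: norm_divide norm_mult)
  then show "norm (deriv g 0) \<le> - 2 * Re (g 0)" using g0 by (simp add: field_simps)
  show "Re (g z) * (1 + norm z) \<le> Re (g 0) * (1 - norm z)" if z: "norm z < 1"
  proof -
    define r a b y where "r = norm z" and "a = Re (g z)" and "b = Re (g 0)"
      and "y = Im (g z) - Im (g 0)"
    have "norm (g z - g 0) \<le> r * norm (g z + cnj (g 0))"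
      using schwarz(1)[OF _ z] nz[OF z] by (simp add: h_def r_def norm_divide field_simps)
    then have "(norm (g z - g 0))\<^sup>2 \<le> r\<^sup>2 * (norm (g z + cnj (g 0)))\<^sup>2"
      by (metis norm_ge_zero power_mono power_mult_distrib)
    then have "(a - b)\<^sup>2 + y\<^sup>2 \<le> r\<^sup>2 * ((a + b)\<^sup>2 + y\<^sup>2)"
      by (simp add: cmod_power2 a_def b_def y_def)
    moreover have "r\<^sup>2 * y\<^sup>2 \<le> 1 * y\<^sup>2"
      using z by (intro mult_right_mono) (auto simp: r_def power_le_one)
    ultimately have "(a - b)\<^sup>2 \<le> (r * (a + b))\<^sup>2"
      unfolding power_mult_distrib distrib_left[of "r\<^sup>2"] by linarith
    then have "\<bar>a - b\<bar> \<le> \<bar>r * (a + b)\<bar>" by (simp add: abs_le_square_iff)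
    also have "\<dots> = r * - (a + b)"
      using neg[OF z] g0 by (simp add: abs_mult r_def a_def b_def)
    finally show ?thesis by (simp add: r_def a_def b_def algebra_simps abs_le_iff)
  qed
qed

subsection \<open>The Kobayashi metric of the plane without two points\<close>

text \<open>\<open>2 / kobayashi_radius z\<close> is the density of the hyperbolic metric of curvature \<open>-1\<close>.\<close>

definition disc_maps :: "complex \<Rightarrow> (complex \<Rightarrow> complex) set" where
  "disc_maps z = {f. f holomorphic_on ball 0 1 \<and> f ` ball 0 1 \<subseteq> - {0, 1} \<and> f 0 = z}"

definition kobayashi_radius :: "complex \<Rightarrow> real" where
  "kobayashi_radius z = (SUP f\<in>disc_maps z. norm (deriv f 0))"

lemma disc_maps_avoid:
  "f \<in> disc_maps z \<Longrightarrow> norm \<zeta> < 1 \<Longrightarrow> f \<zeta> \<noteq> 0 \<and> f \<zeta> \<noteq> 1"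
  by (force simp: disc_maps_def image_subset_iff)

text \<open>Schottky's theorem speaks of functions on the closed disc; shrinking the argument by
  \<open>s\<close> makes it applicable to functions on the open disc.\<close>

lemma disc_maps_scale:
  assumes f: "f \<in> disc_maps z" and s: "0 < s" "s < 1"
  shows "(\<lambda>\<zeta>. f (of_real s * \<zeta>)) holomorphic_on cball 0 1"
    and "\<And>\<zeta>. norm \<zeta> \<le> 1 \<Longrightarrow> f (of_real s * \<zeta>) \<noteq> 0 \<and> f (of_real s * \<zeta>) \<noteq> 1"
proof -
  have in_ball: "of_real s * \<zeta> \<in> ball 0 1" if "norm \<zeta> \<le> 1" for \<zeta> :: complex
    using mult_left_mono[OF that, of s] s by (simp add: norm_mult order.strict_trans1[of _ s])
  have "(f \<circ> (\<lambda>\<zeta>. of_real s * \<zeta>)) holomorphic_on cball 0 1"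
    using f in_ball
    by (intro holomorphic_on_compose_gen[of _ _ f "ball 0 1"] holomorphic_intros)
       (auto simp: disc_maps_def)
  then show "(\<lambda>\<zeta>. f (of_real s * \<zeta>)) holomorphic_on cball 0 1" by (simp add: o_def)
  show "f (of_real s * \<zeta>) \<noteq> 0 \<and> f (of_real s * \<zeta>) \<noteq> 1" if "norm \<zeta> \<le> 1" for \<zeta>
    using disc_maps_avoid[OF f] in_ball[OF that] by auto
qed

lemma disc_maps_has_derivative:
  assumes "f \<in> disc_maps z" "norm \<zeta> < 1"
  shows "(f has_field_derivative deriv f \<zeta>) (at \<zeta>)"
  using assms by (intro holomorphic_derivI[of _ "ball 0 1"]) (auto simp: disc_maps_def)

text \<open>Finiteness of the supremum is Landau's theorem: the radius of a disc on which a function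
  omits 0 and 1 is bounded in terms of its value and derivative at the centre.\<close>

lemma bdd_above_disc_maps: "bdd_above ((\<lambda>f. norm (deriv f 0)) ` disc_maps z)"
proof -
  obtain R where Rpos: "\<And>z :: complex. 0 < R z"
    and R: "\<And>f. \<lbrakk>f holomorphic_on cball 0 (R (f 0));
               \<And>z. norm z \<le> R (f 0) \<Longrightarrow> f z \<noteq> 0 \<and> f z \<noteq> 1\<rbrakk> \<Longrightarrow> norm (deriv f 0) < 1"
    using Landau_Picard by blast
  have "norm (deriv f 0) \<le> 2 * R z" if f: "f \<in> disc_maps z" for f
  proof -
    \<comment> \<open>The factor 2 keeps the image of the closed disc of radius \<open>R z\<close>
      inside the open unit disc.\<close>
    define c where "c = (1 / (2 * R z))"
    have c: "c > 0" using Rpos[of z] by (simp add: c_def)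
    define g where "g = (\<lambda>\<zeta>. f (of_real c * \<zeta>))"
    have g0: "g 0 = z" using f by (simp add: g_def disc_maps_def)
    have in_ball: "of_real c * \<zeta> \<in> ball 0 1" if "norm \<zeta> \<le> R z" for \<zeta> :: complex
    proof -
      have "norm (of_real c * \<zeta>) = c * norm \<zeta>" using c by (simp add: norm_mult)
      also have "\<dots> \<le> c * R z" using that c by (intro mult_left_mono) auto
      also have "\<dots> < 1" using Rpos[of z] by (simp add: c_def)
      finally show ?thesis by simp
    qed
    have "(f \<circ> (\<lambda>\<zeta>. of_real c * \<zeta>)) holomorphic_on cball 0 (R z)"
      using f in_ball
      by (intro holomorphic_on_compose_gen[of _ _ f "ball 0 1"] holomorphic_intros)
         (auto simp: disc_maps_def)
    then have "norm (deriv g 0) < 1"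
      using disc_maps_avoid[OF f] in_ball by (intro R) (auto simp: g0, auto simp: g_def o_def)
    moreover have "(g has_field_derivative deriv f 0 * of_real c) (at 0)"
      unfolding g_def using disc_maps_has_derivative[OF f, of 0]
      by (intro DERIV_chain'[of "\<lambda>\<zeta>. of_real c * \<zeta>" _ 0 _ f, THEN DERIV_cong])
         (auto intro!: derivative_eq_intros)
    ultimately have "norm (deriv f 0) * c < 1"
      using c by (simp add: DERIV_imp_deriv norm_mult)
    then show ?thesis using Rpos[of z] by (simp add: c_def field_simps)
  qed
  then show ?thesis by (auto intro!: bdd_aboveI[of _ "2 * R z"])
qed

lemma norm_deriv_le_kobayashi_radius:
  "f \<in> disc_maps z \<Longrightarrow> norm (deriv f 0) \<le> kobayashi_radius z"
  unfolding kobayashi_radius_def by (intro cSUP_upper bdd_above_disc_maps)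

lemma kobayashi_radius_le:
  assumes "z \<noteq> 0" "z \<noteq> 1" "\<And>f. f \<in> disc_maps z \<Longrightarrow> norm (deriv f 0) \<le> c"
  shows "kobayashi_radius z \<le> c"
proof -
  have "(\<lambda>_. z) \<in> disc_maps z" using assms by (auto simp: disc_maps_def)
  then show ?thesis unfolding kobayashi_radius_def using assms by (intro cSUP_least) auto
qed

text \<open>If discs can be lifted through \<open>s\<close>, then \<open>s\<close> is a local isometry and \<open>t\<close> is a contraction.\<close>

lemma kobayashi_radius_lift_le:
  assumes "open S" "w \<in> S"
    and s: "s holomorphic_on S" "s ` S \<subseteq> - {0, 1}"
    and t: "t holomorphic_on S" "t ` S \<subseteq> - {0, 1}"
    and lift: "\<And>f. f \<in> disc_maps (s w) \<Longrightarrow> \<exists>h. h holomorphic_on ball 0 1 \<and> h ` ball 0 1 \<subseteq> S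
                 \<and> h 0 = w \<and> (\<forall>\<zeta>\<in>ball 0 1. f \<zeta> = s (h \<zeta>))"
  shows "norm (deriv t w) * kobayashi_radius (s w) \<le> norm (deriv s w) * kobayashi_radius (t w)"
proof -
  have bound: "norm (deriv t w) * norm (deriv f 0) \<le> norm (deriv s w) * kobayashi_radius (t w)"
    if f: "f \<in> disc_maps (s w)" for f
  proof -
    obtain h where h: "h holomorphic_on ball 0 1" "h ` ball 0 1 \<subseteq> S" "h 0 = w"
      and fh: "\<And>\<zeta>. \<zeta> \<in> ball 0 1 \<Longrightarrow> f \<zeta> = s (h \<zeta>)"
      using lift[OF f] by blast
    have dh: "(h has_field_derivative deriv h 0) (at 0)"
      using h by (intro holomorphic_derivI[of _ "ball 0 1"]) auto
    have ds: "(s has_field_derivative deriv s w) (at (h 0))"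
         and dt: "(t has_field_derivative deriv t w) (at (h 0))"
      using s t assms(1,2) h(3) by (auto intro!: holomorphic_derivI[of _ S])
    have df: "deriv f 0 = deriv s w * deriv h 0"
    proof (rule DERIV_imp_deriv, rule has_field_derivative_transform_within_open[of _ _ _ "ball 0 1"])
      show "((\<lambda>\<zeta>. s (h \<zeta>)) has_field_derivative deriv s w * deriv h 0) (at 0)"
        using DERIV_chain'[OF dh ds] by (simp add: mult.commute)
    qed (use fh in auto)
    \<comment> \<open>The lift pushed through \<open>t\<close> competes for the radius at
      \<open>t w\<close>. Eliminating \<open>deriv h 0\<close> between the two chain rules by
      multiplication avoids any division by \<open>deriv s w\<close>.\<close>
    have "(\<lambda>\<zeta>. t (h \<zeta>)) \<in> disc_maps (t w)"
      using h t holomorphic_on_compose_gen[of h "ball 0 1" t S]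
      by (auto simp: disc_maps_def o_def)
    moreover have "deriv (\<lambda>\<zeta>. t (h \<zeta>)) 0 = deriv t w * deriv h 0"
      using DERIV_imp_deriv[OF DERIV_chain'[OF dh dt]] by (simp add: mult.commute)
    ultimately have "norm (deriv t w) * norm (deriv h 0) \<le> kobayashi_radius (t w)"
      using norm_deriv_le_kobayashi_radius by (fastforce simp: norm_mult)
    then have "norm (deriv s w) * (norm (deriv t w) * norm (deriv h 0))
        \<le> norm (deriv s w) * kobayashi_radius (t w)"
      by (intro mult_left_mono) auto
    then show ?thesis by (simp add: df norm_mult mult_ac)
  qed
  have nonneg: "0 \<le> kobayashi_radius (t w)"
    using norm_deriv_le_kobayashi_radius[of "\<lambda>_. t w" "t w"] t assms(2)
    by (auto simp: disc_maps_def)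
  show ?thesis
  proof (cases "deriv t w = 0")
    case True
    then show ?thesis using nonneg by simp
  next
    case False
    have "kobayashi_radius (s w) \<le> norm (deriv s w) * kobayashi_radius (t w) / norm (deriv t w)"
      using s assms(2) bound False
      by (intro kobayashi_radius_le) (auto simp: field_simps)
    then show ?thesis using False by (simp add: field_simps)
  qed
qed

text \<open>Discs lift through both \<open>s\<close> and \<open>t\<close>, so the preceding
  inequality holds with the two maps in either role, and together the two inequalities give
  equality.\<close>

lemma kobayashi_radius_Landen:
  assumes w: "w \<noteq> 0" "w \<noteq> 1" "w \<noteq> -1"
  shows "norm (4 * (1 - w) / (1 + w) ^ 3) * kobayashi_radius (w\<^sup>2)
       = norm (2 * w) * kobayashi_radius (4 * w / (1 + w)\<^sup>2)"
proof -
  define S where "S = - {0, 1, -1 :: complex}"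
  define s where "s = (\<lambda>z :: complex. z\<^sup>2)"
  define t where "t = (\<lambda>z :: complex. 4 * z / (1 + z)\<^sup>2)"
  have nz: "1 + z \<noteq> 0" if "z \<noteq> -1" for z :: complex
    using that by (metis add_eq_0_iff)
  have S: "open S" "w \<in> S" using w by (auto simp: S_def intro!: open_Compl)
  have hols: "s holomorphic_on S" unfolding s_def by (intro holomorphic_intros)
  have holt: "t holomorphic_on S"
    unfolding t_def using nz by (intro holomorphic_intros) (auto simp: S_def)
  \<comment> \<open>In the coordinates (1 - z) / (1 + z) upstairs and 1 - \<open>t z\<close>
    downstairs, \<open>t\<close> is again the squaring map; lifting through \<open>t\<close> thus
    also reduces to taking a square root.\<close>
  have t1: "1 - t z = ((1 - z) / (1 + z))\<^sup>2" if "z \<noteq> -1" for z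
  proof -
    have "1 - t z = ((1 + z)\<^sup>2 - 4 * z) / (1 + z)\<^sup>2"
      using nz[OF that] by (simp add: t_def diff_divide_distrib)
    also have "(1 + z)\<^sup>2 - 4 * z = (1 - z)\<^sup>2" by (simp add: power2_eq_square algebra_simps)
    finally show ?thesis by (simp add: power_divide)
  qed
  have ims: "s ` S \<subseteq> - {0, 1}" by (auto simp: s_def S_def power2_eq_1_iff)
  have "t z \<noteq> 1" if "z \<in> S" for z
  proof -
    have "1 - t z \<noteq> 0" using that nz[of z] by (subst t1) (auto simp: S_def)
    then show ?thesis by auto
  qed
  moreover have "t z \<noteq> 0" if "z \<in> S" for z
    using that nz[of z] by (auto simp: t_def S_def)
  ultimately have imt: "t ` S \<subseteq> - {0, 1}" by auto
  have ds: "deriv s w = 2 * w"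
    unfolding s_def by (rule DERIV_imp_deriv) (auto intro!: derivative_eq_intros)
  have dt: "deriv t w = 4 * (1 - w) / (1 + w) ^ 3"
  proof (rule DERIV_imp_deriv)
    have u: "1 + w \<noteq> 0" by (rule nz[OF w(3)])
    have "(t has_field_derivative (4 * (1 + w)\<^sup>2 - 4 * w * (2 * (1 + w))) / ((1 + w)\<^sup>2 * (1 + w)\<^sup>2)) (at w)"
      unfolding t_def using u by (auto intro!: derivative_eq_intros)
    also have "4 * (1 + w)\<^sup>2 - 4 * w * (2 * (1 + w)) = 4 * (1 - w) * (1 + w)"
      by (simp add: power2_eq_square algebra_simps)
    also have "4 * (1 - w) * (1 + w) / ((1 + w)\<^sup>2 * (1 + w)\<^sup>2) = 4 * (1 - w) / (1 + w) ^ 3"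
    proof -
      have "(1 + w)\<^sup>2 * (1 + w)\<^sup>2 = (1 + w) ^ 3 * (1 + w)"
        by (simp add: power2_eq_square power3_eq_cube mult_ac)
      then show ?thesis using u by simp
    qed
    finally show "(t has_field_derivative 4 * (1 - w) / (1 + w) ^ 3) (at w)" .
  qed
  have contr: "contractible (ball 0 1 :: complex set)"
    by (intro convex_imp_contractible convex_ball)
  have lifts: "\<exists>h. h holomorphic_on ball 0 1 \<and> h ` ball 0 1 \<subseteq> S \<and> h 0 = w \<and> (\<forall>\<zeta>\<in>ball 0 1. f \<zeta> = s (h \<zeta>))"
    if f: "f \<in> disc_maps (s w)" for f
  proof -
    obtain g where g: "g holomorphic_on ball 0 1" "\<And>z. z \<in> ball 0 1 \<Longrightarrow> f z = (g z)\<^sup>2"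
      using contractible_imp_holomorphic_sqrt[OF _ contr, of f] disc_maps_avoid[OF f] f
      by (auto simp: disc_maps_def)
    have gS: "g z \<noteq> 0 \<and> g z \<noteq> 1 \<and> g z \<noteq> -1" if "z \<in> ball 0 1" for z
      using g(2)[OF that] disc_maps_avoid[OF f, of z] that by auto
    \<comment> \<open>The square root is determined up to sign, and one of the two signs starts at
      \<open>w\<close>.\<close>
    have "(g 0)\<^sup>2 = w\<^sup>2" using g(2)[of 0] f by (simp add: disc_maps_def s_def)
    then consider "g 0 = w" | "g 0 = - w" by (auto simp: power2_eq_iff)
    then show ?thesis
    proof cases
      case 1
      then show ?thesis using g gS by (intro exI[of _ g]) (auto simp: S_def s_def)
    next
      case 2
      have "- g z \<in> S" if "z \<in> ball 0 1" for z
      proof -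
        have "- g z \<noteq> 1"
        proof
          assume "- g z = 1"
          from arg_cong[OF this, of uminus] show False using gS[OF that] by simp
        qed
        then show ?thesis using gS[OF that] by (simp add: S_def)
      qed
      then have "(\<lambda>z. - g z) ` ball 0 1 \<subseteq> S" by blast
      moreover have "(\<lambda>z. - g z) holomorphic_on ball 0 1" by (intro holomorphic_intros g)
      moreover have "f \<zeta> = s (- g \<zeta>)" if "\<zeta> \<in> ball 0 1" for \<zeta>
        using g(2)[OF that] by (simp add: s_def)
      moreover have "- g 0 = w" using 2 by simp
      ultimately show ?thesis by (intro exI[of _ "\<lambda>z. - g z"] conjI ballI)
    qed
  qed
  have liftt: "\<exists>h. h holomorphic_on ball 0 1 \<and> h ` ball 0 1 \<subseteq> S \<and> h 0 = w \<and> (\<forall>\<zeta>\<in>ball 0 1. f \<zeta> = t (h \<zeta>))"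
    if f: "f \<in> disc_maps (t w)" for f
  proof -
    have "(\<lambda>z. 1 - f z) holomorphic_on ball 0 1"
      using f by (intro holomorphic_intros) (simp add: disc_maps_def)
    moreover have "1 - f z \<noteq> 0" if "z \<in> ball 0 1" for z
      using disc_maps_avoid[OF f, of z] that by auto
    ultimately obtain k where k: "k holomorphic_on ball 0 1" "\<And>z. z \<in> ball 0 1 \<Longrightarrow> 1 - f z = (k z)\<^sup>2"
      using contractible_imp_holomorphic_sqrt[OF _ contr, of "\<lambda>z. 1 - f z"] by metis
    \<comment> \<open>The map m -> (1 - m) / (1 + m) is an involution, so it turns a root
      \<open>m\<close> of 1 - \<open>f\<close> with the right initial value into the lift. Omitting
      0, 1 and -1 is preserved: m = 1 corresponds to h = 0 and m = 0 to h = 1.\<close>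
    have lift_of: ?thesis
      if m: "m holomorphic_on ball 0 1" "\<And>z. z \<in> ball 0 1 \<Longrightarrow> 1 - f z = (m z)\<^sup>2"
        and m0: "m 0 = (1 - w) / (1 + w)" for m
    proof -
      have m1: "m z \<noteq> 0" "1 + m z \<noteq> 0" "m z \<noteq> 1" if "z \<in> ball 0 1" for z
      proof -
        have "(m z)\<^sup>2 \<noteq> 0" "(m z)\<^sup>2 \<noteq> 1"
          using m(2)[OF that, symmetric] disc_maps_avoid[OF f, of z] that by simp_all
        then have "m z \<noteq> 0" "m z \<noteq> 1" "m z \<noteq> -1" by (auto simp: power2_eq_1_iff)
        then show "m z \<noteq> 0" "1 + m z \<noteq> 0" "m z \<noteq> 1" using nz by auto
      qed
      define h where "h = (\<lambda>z. (1 - m z) / (1 + m z))"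
      have "h holomorphic_on ball 0 1"
        unfolding h_def using m1 by (intro holomorphic_intros m) auto
      moreover have "h ` ball 0 1 \<subseteq> S"
        using m1 by (auto simp: h_def S_def field_simps)
      moreover have "h 0 = w"
      proof -
        have "1 + m 0 = 2 / (1 + w)" "1 - m 0 = 2 * w / (1 + w)"
          using nz[OF w(3)] by (simp_all add: m0 field_simps)
        then show ?thesis using nz[OF w(3)] by (simp add: h_def)
      qed
      moreover have "f z = t (h z)" if z: "z \<in> ball 0 1" for z
      proof -
        have "1 + h z = 2 / (1 + m z)" using m1[OF z] by (simp add: h_def field_simps)
        then have "t (h z) = (1 - m z) * (1 + m z)"
          using m1[OF z] by (simp add: t_def) (simp add: h_def power2_eq_square)
        also have "\<dots> = 1 - (m z)\<^sup>2" by (simp add: power2_eq_square algebra_simps)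
        finally show ?thesis using m(2)[OF z, symmetric] by simp
      qed
      ultimately show ?thesis by blast
    qed
    have "(k 0)\<^sup>2 = ((1 - w) / (1 + w))\<^sup>2"
      using k(2)[of 0] f t1[OF w(3)] by (simp add: disc_maps_def)
    then consider "k 0 = (1 - w) / (1 + w)" | "- k 0 = (1 - w) / (1 + w)"
      by (auto simp: power2_eq_iff minus_equation_iff[of "k 0"])
    then show ?thesis
      using lift_of[of k] lift_of[of "\<lambda>z. - k z"] k by cases (auto intro: holomorphic_intros)
  qed
  show ?thesis
    using kobayashi_radius_lift_le[OF S hols ims holt imt lifts]
      kobayashi_radius_lift_le[OF S holt imt hols ims liftt]
    unfolding ds dt by (simp add: s_def t_def)
qed

subsection \<open>The metric near a cusp\<close>

text \<open>The density of the hyperbolic metric at \<open>z\<close> is \<open>1 / (|z| cusp_height z)\<close>; in the punctured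
  unit disc the corresponding height is \<open>- ln |z|\<close>.\<close>

definition cusp_height :: "complex \<Rightarrow> real" where
  "cusp_height z = kobayashi_radius z / (2 * norm z)"

text \<open>The descending Landen transformation of elliptic integrals in terms of the parameter z =
  k^2: with k' = \<open>csqrt (1 - z)\<close> the inner quotient is (1 - k') / (1 + k') whenever it
  is written out. It inverts w -> 4 w / (1 + w)^2 and then squares; this form of the quotient makes
  its size at 0 visible.\<close>

definition Landen :: "complex \<Rightarrow> complex" where
  "Landen z = (z / (1 + csqrt (1 - z))\<^sup>2)\<^sup>2"

lemma one_plus_csqrt_norm: "1 \<le> norm (1 + csqrt z)"
proof -
  have "1 \<le> Re (1 + csqrt z)" using csqrt_principal[of z] by auto
  then show ?thesis using complex_Re_le_cmod order_trans by blast
qed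

text \<open>The true order at 0 is |z|^2 / 16, but this crude bound already makes the iterates
  converge quadratically to the cusp.\<close>

lemma norm_Landen_le: "norm (Landen z) \<le> (norm z)\<^sup>2"
proof -
  have "norm (z / (1 + csqrt (1 - z))\<^sup>2) \<le> norm z / 1"
    unfolding norm_divide norm_power
    using one_plus_csqrt_norm[of "1 - z"] by (intro divide_left_mono) auto
  then show ?thesis unfolding Landen_def norm_power by (intro power_mono) auto
qed

lemma Landen_eq_0_iff [simp]: "Landen z = 0 \<longleftrightarrow> z = 0"
  using one_plus_csqrt_norm[of "1 - z"] by (auto simp: Landen_def)

text \<open>This is \<open>kobayashi_radius_Landen\<close> at w = (1 - k) / (1 + k), where 4 w / (1
  + w)^2 = z and w^2 = \<open>Landen z\<close>. Because |z| = |w| |1 + k|^2, the powers of |1 + k|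
  cancel once radii are replaced by heights, leaving |k| / 2.\<close>

lemma cusp_height_Landen:
  assumes z: "z \<noteq> 0" "z \<noteq> 1"
  shows "cusp_height z = sqrt (norm (1 - z)) / 2 * cusp_height (Landen z)"
proof -
  define k where "k = csqrt (1 - z)"
  define w where "w = (1 - k) / (1 + k)"
  have k2: "k\<^sup>2 = 1 - z" by (simp add: k_def)
  have k1: "1 + k \<noteq> 0" using one_plus_csqrt_norm[of "1 - z"] by (auto simp: k_def)
  have k0: "k \<noteq> 0" "k \<noteq> 1" using k2 z by auto
  have w: "w \<noteq> 0" "w \<noteq> 1" "w \<noteq> -1"
    using k0 k1 by (auto simp: w_def field_simps)
  have w1: "1 + w = 2 / (1 + k)" "1 - w = 2 * k / (1 + k)"
    using k1 by (auto simp: w_def field_simps)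
  have zk: "z = (1 - k) * (1 + k)" using k2 by (simp add: power2_eq_square algebra_simps)
  have "z / (1 + k)\<^sup>2 = w" using k1 by (simp add: zk w_def power2_eq_square)
  then have Lz: "Landen z = w\<^sup>2" by (simp add: Landen_def k_def)
  have "4 * w / (1 + w)\<^sup>2 = z"
    using k1 by (simp add: w1) (simp add: w_def zk power2_eq_square)
  then have *: "norm (4 * (1 - w) / (1 + w) ^ 3) * kobayashi_radius (w\<^sup>2) = norm (2 * w) * kobayashi_radius z"
    using kobayashi_radius_Landen[OF w] by simp
  have "4 * (1 - w) / (1 + w) ^ 3 = k * (1 + k)\<^sup>2"
  proof -
    have "4 * (2 * k / u) / (2 / u) ^ 3 = k * u\<^sup>2" if "u \<noteq> 0" for u
      using that by (simp add: power_divide) (simp add: power2_eq_square power3_eq_cube)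
    from this[OF k1] show ?thesis unfolding w1 .
  qed
  with * have "norm k * (norm (1 + k))\<^sup>2 * kobayashi_radius (w\<^sup>2) = 2 * norm w * kobayashi_radius z"
    by (simp add: norm_mult norm_power)
  then have "kobayashi_radius z = norm k * (norm (1 + k))\<^sup>2 * kobayashi_radius (w\<^sup>2) / (2 * norm w)"
    using w by (simp add: field_simps)
  moreover have "norm z = norm w * (norm (1 + k))\<^sup>2"
    using k1 by (simp add: zk w_def norm_mult norm_divide power2_eq_square)
  moreover have "norm k = sqrt (norm (1 - z))" by (simp add: k_def)
  ultimately show ?thesis
    using w k1 by (simp add: cusp_height_def Lz norm_power norm_mult power2_eq_square divide_simps mult_ac)
qed

section \<open>Leading behaviour of the height at the cusp\<close>

lemma Re_Cayley_pos:
  fixes z :: complex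
  assumes "norm z < 1"
  shows "0 < Re ((1 + z) / (1 - z))"
proof -
  have "Re ((1 + z) / (1 - z)) = (1 - (norm z)\<^sup>2) / (norm (1 - z))\<^sup>2"
    unfolding Re_divide cmod_power2
    by (simp add: add_divide_distrib[symmetric]) (simp add: power2_eq_square algebra_simps)
  also have "\<dots> > 0"
  proof (rule divide_pos_pos)
    show "0 < 1 - (norm z)\<^sup>2" using assms by (simp add: power_less_one_iff)
    show "0 < (norm (1 - z))\<^sup>2" using assms by auto
  qed
  finally show ?thesis .
qed

text \<open>The punctured unit disc lies in the plane without 0 and 1, so its universal covering is
  a competitor. It is written as the exponential of a Cayley transform onto the left half plane,
  normalised so that 0 goes to \<open>Ln z\<close> and hence to \<open>z\<close>.\<close>

lemma cusp_height_ge: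
  assumes z: "z \<noteq> 0" "norm z < 1"
  shows "- ln (norm z) \<le> cusp_height z"
proof -
  define l where "l = Ln z"
  have l: "exp l = z" "Re l = ln (norm z)" using z by (auto simp: l_def)
  have lneg: "Re l < 0" using z l by simp
  define f where "f = (\<lambda>\<zeta> :: complex. exp (\<i> * Im l + Re l * ((1 + \<zeta>) / (1 - \<zeta>))))"
  have nz: "1 - \<zeta> \<noteq> 0" if "norm \<zeta> < 1" for \<zeta> :: complex using that by auto
  have lt: "norm (f \<zeta>) < 1" if "norm \<zeta> < 1" for \<zeta>
  proof -
    show ?thesis
      using mult_neg_pos[OF lneg Re_Cayley_pos[OF that]] by (simp add: f_def del: times_divide_eq_right)
  qed
  have f0: "f 0 = z"
    using l(1) complex_eq[of l] by (simp add: f_def algebra_simps)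
  have "f \<in> disc_maps z"
    unfolding disc_maps_def mem_Collect_eq
  proof (intro conjI f0)
    show "f holomorphic_on ball 0 1"
      unfolding f_def using nz by (intro holomorphic_intros) auto
    show "f ` ball 0 1 \<subseteq> - {0, 1}"
    proof (intro image_subsetI)
      fix \<zeta> :: complex assume "\<zeta> \<in> ball 0 1"
      then have "f \<zeta> \<noteq> 1" using lt[of \<zeta>] by auto
      then show "f \<zeta> \<in> - {0, 1}" by (simp add: f_def)
    qed
  qed
  moreover have "deriv f 0 = z * (2 * Re l)"
  proof (rule DERIV_imp_deriv)
    have "((\<lambda>\<zeta>. (1 + \<zeta>) / (1 - \<zeta>)) has_field_derivative 2) (at (0 :: complex))"
      by (auto intro!: derivative_eq_intros)
    from DERIV_cmult[OF this, of "Re l"]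
    have "((\<lambda>\<zeta>. \<i> * Im l + Re l * ((1 + \<zeta>) / (1 - \<zeta>))) has_field_derivative Re l * 2) (at (0 :: complex))"
      by (auto intro!: derivative_eq_intros)
    from DERIV_fun_exp[OF this] show "(f has_field_derivative z * (2 * Re l)) (at 0)"
      using f0 by (simp add: f_def mult_ac)
  qed
  ultimately have "norm (z * (2 * Re l)) \<le> kobayashi_radius z"
    using norm_deriv_le_kobayashi_radius[of f z] by simp
  then show ?thesis using z lneg by (simp add: cusp_height_def norm_mult field_simps l(2))
qed

text \<open>Schottky's theorem bounds |f| on a smaller disc by a constant exp B independent of
  \<open>f\<close>. Then ln |f| - B is a negative harmonic function there, and by Harnack's
  inequality a very negative value at 0 forces it below -B on a slightly smaller disc.\<close>

lemma disc_maps_small: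
  assumes t: "0 < t" "t < 1"
  shows "\<exists>\<delta>>0. \<delta> < 1 \<and>
    (\<forall>z f \<zeta>. f \<in> disc_maps z \<and> norm z < \<delta> \<and> norm \<zeta> < t \<longrightarrow> norm (f \<zeta>) < 1)"
proof -
  \<comment> \<open>Three shrinkings by the factor \<open>s\<close> follow: to reach the closed
    disc, to apply Schottky's theorem, and to apply Harnack's inequality.\<close>
  define s where "s = root 3 t"
  have s: "0 < s" "s < 1" "s ^ 3 = t" using t by (auto simp: s_def)
  have s2: "s\<^sup>2 < 1" using s by (simp add: power_less_one_iff)
  \<comment> \<open>Schottky's exponent for |f 0| at most 1 and radius \<open>s\<close>; the extra 1
    makes the real part of \<open>g\<close> strictly negative.\<close>
  define B where "B = pi * exp (pi * (2 + 2 * 1 + 12 * s / (1 - s))) + 1"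
  have B: "B > 0" by (simp add: B_def add_pos_pos)
  \<comment> \<open>Chosen so that Re (g 0) < -2 B / (1 - s). Harnack's factor 1 - s turns this into
    -2 B, and 1 + |\<eta>| < 2 leaves Re (g \<eta>) < -B. The exponent is negative, hence \<delta> <
    1.\<close>
  define \<delta> where "\<delta> = exp (B - 2 * B / (1 - s))"
  have "B < 2 * B / (1 - s)" using s B by (simp add: field_simps mult_pos_pos add_pos_pos)
  then have \<delta>: "0 < \<delta>" "\<delta> < 1" by (auto simp: \<delta>_def)
  have "norm (f \<zeta>) < 1" if f: "f \<in> disc_maps z" and z: "norm z < \<delta>" and \<zeta>: "norm \<zeta> < t" for f z \<zeta>
  proof -
    obtain k where k: "k holomorphic_on ball 0 1" "\<And>\<xi>. \<xi> \<in> ball 0 1 \<Longrightarrow> f \<xi> = exp (k \<xi>)"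
      using contractible_imp_holomorphic_log[of f "ball 0 1"] convex_imp_contractible[OF convex_ball]
        disc_maps_avoid[OF f] f by (auto simp: disc_maps_def)
    have f0: "f 0 = z" using f by (simp add: disc_maps_def)
    have z0: "z \<noteq> 0" using disc_maps_avoid[OF f, of 0] f0 by auto
    define g where "g = (\<lambda>\<xi>. k (of_real (s\<^sup>2) * \<xi>) - of_real B)"
    have in_ball: "of_real (s\<^sup>2) * \<xi> \<in> ball 0 1" if "norm \<xi> < 1" for \<xi> :: complex
      using that mult_strict_mono[of "s\<^sup>2" 1 "norm \<xi>" 1] s2 by (simp add: norm_mult norm_power)
    have "(k \<circ> (\<lambda>\<xi>. of_real (s\<^sup>2) * \<xi>)) holomorphic_on ball 0 1"
      using k in_ball by (intro holomorphic_on_compose_gen[of _ _ k "ball 0 1"] holomorphic_intros) auto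
    then have holg: "g holomorphic_on ball 0 1"
      unfolding g_def o_def by (intro holomorphic_intros)
    have neg: "Re (g \<xi>) < 0" if "norm \<xi> < 1" for \<xi>
    proof -
      have "norm (of_real s * \<xi>) \<le> s"
        using that s mult_left_mono[of "norm \<xi>" 1 s] by (simp add: norm_mult)
      then have "norm (f (of_real s * (of_real s * \<xi>))) \<le> exp (B - 1)"
        using Schottky[OF disc_maps_scale(1)[OF f s(1,2)], of 1 s "of_real s * \<xi>"]
          disc_maps_scale(2)[OF f s(1,2)] f0 z \<delta> s by (simp add: B_def)
      then have "exp (Re (k (of_real (s\<^sup>2) * \<xi>))) \<le> exp (B - 1)"
        using k(2)[OF in_ball[OF that]] by (simp add: power2_eq_square mult.assoc)
      then show ?thesis by (simp add: g_def)
    qed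
    have "exp (Re (k 0)) = norm z" using k(2)[of 0] f0 by simp
    then have "Re (k 0) < B - 2 * B / (1 - s)" using z unfolding \<delta>_def by (metis exp_less_cancel_iff)
    then have g0: "Re (g 0) < - 2 * B / (1 - s)" by (simp add: g_def)
    define \<eta> where "\<eta> = \<zeta> / of_real (s\<^sup>2)"
    have "norm \<eta> < s"
    proof -
      have "norm \<zeta> < s * s\<^sup>2" using \<zeta> s(3) by (simp only: power3_eq_cube power2_eq_square mult.assoc)
      then have "norm \<zeta> / s\<^sup>2 < s" using s(1) by (simp add: divide_less_eq)
      then show ?thesis by (simp add: \<eta>_def norm_divide norm_power)
    qed
    then have \<eta>: "norm \<eta> < s" "norm \<eta> < 1" using s by auto
    have "Re (g \<eta>) * (1 + norm \<eta>) \<le> Re (g 0) * (1 - norm \<eta>)"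
      by (rule Harnack_halfplane[OF holg neg \<eta>(2)])
    also have "\<dots> \<le> Re (g 0) * (1 - s)"
      using neg[of 0] \<eta> by (intro mult_left_mono_neg) auto
    also have "\<dots> < - 2 * B" using g0 s by (simp add: field_simps)
    also have "\<dots> \<le> - B * (1 + norm \<eta>)" using B \<eta> by simp
    finally have "Re (g \<eta>) < - B"
      by (meson add_pos_nonneg mult_less_cancel_right_pos norm_ge_zero zero_less_one)
    then have "Re (k \<zeta>) < 0" using s by (simp add: g_def \<eta>_def)
    moreover have "\<zeta> \<in> ball 0 1" using \<zeta> t by simp
    ultimately show ?thesis using k(2) by simp
  qed
  then show ?thesis using \<delta> by blast
qed

text \<open>Near the cusp, \<open>disc_maps_small\<close> makes a logarithm of \<open>f\<close> map
  the disc of radius \<open>t\<close> into the left half plane. The half-plane derivative bound for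
  this logarithm, whose real part at 0 is ln |z|, bounds the derivative of \<open>f\<close>.\<close>

lemma cusp_height_le:
  assumes t: "0 < t" "t < 1"
  shows "\<exists>\<delta>>0. \<delta> < 1 \<and> (\<forall>z. z \<noteq> 0 \<and> norm z < \<delta> \<longrightarrow> t * cusp_height z \<le> - ln (norm z))"
proof -
  obtain \<delta> where \<delta>: "0 < \<delta>" "\<delta> < 1"
    and small: "\<And>f z \<zeta>. f \<in> disc_maps z \<Longrightarrow> norm z < \<delta> \<Longrightarrow> norm \<zeta> < t \<Longrightarrow> norm (f \<zeta>) < 1"
    using disc_maps_small[OF t] by blast
  have "t * cusp_height z \<le> - ln (norm z)" if z: "z \<noteq> 0" "norm z < \<delta>" for z
  proof -
    have "norm (deriv f 0) \<le> - 2 * norm z * ln (norm z) / t" if f: "f \<in> disc_maps z" for f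
    proof -
      obtain k where k: "k holomorphic_on ball 0 1" "\<And>\<xi>. \<xi> \<in> ball 0 1 \<Longrightarrow> f \<xi> = exp (k \<xi>)"
        using contractible_imp_holomorphic_log[of f "ball 0 1"] convex_imp_contractible[OF convex_ball]
          disc_maps_avoid[OF f] f by (auto simp: disc_maps_def)
      have f0: "f 0 = z" using f by (simp add: disc_maps_def)
      have k0: "exp (k 0) = z" using k(2)[of 0] f0 by simp
      then have "norm z = exp (Re (k 0))" by (metis norm_exp_eq_Re)
      then have Rek0: "Re (k 0) = ln (norm z)" by simp
      have dk: "(k has_field_derivative deriv k 0) (at 0)"
        using k by (intro holomorphic_derivI[of _ "ball 0 1"]) auto
      have "(f has_field_derivative z * deriv k 0) (at 0)"
      proof (rule has_field_derivative_transform_within_open[of _ _ _ "ball 0 1"])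
        show "((\<lambda>\<zeta>. exp (k \<zeta>)) has_field_derivative z * deriv k 0) (at 0)"
          using k0 by (auto intro!: derivative_eq_intros dk)
      qed (use k in auto)
      then have df: "deriv f 0 = z * deriv k 0" by (rule DERIV_imp_deriv)
      define g where "g = (\<lambda>\<xi>. k (of_real t * \<xi>))"
      have lt: "norm (of_real t * \<xi>) < t" if "norm \<xi> < 1" for \<xi> :: complex
        using that t by (simp add: norm_mult)
      have in_ball: "of_real t * \<xi> \<in> ball 0 1" if "norm \<xi> < 1" for \<xi> :: complex
        using lt[OF that] t by simp
      have "(k \<circ> (\<lambda>\<xi>. of_real t * \<xi>)) holomorphic_on ball 0 1"
        using k in_ball by (intro holomorphic_on_compose_gen[of _ _ k "ball 0 1"] holomorphic_intros) auto
      then have holg: "g holomorphic_on ball 0 1" unfolding g_def o_def .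
      have neg: "Re (g \<xi>) < 0" if "norm \<xi> < 1" for \<xi>
        using small[OF f z(2) lt[OF that]] k(2)[OF in_ball[OF that]] by (simp add: g_def)
      have "((\<lambda>\<xi>. k (of_real t * \<xi>)) has_field_derivative deriv k 0 * of_real t) (at 0)"
        using dk by (intro DERIV_chain'[of "\<lambda>\<zeta>. of_real t * \<zeta>" _ 0 _ k, THEN DERIV_cong])
         (auto intro!: derivative_eq_intros)
      then have "deriv g 0 = deriv k 0 * of_real t" unfolding g_def by (rule DERIV_imp_deriv)
      then have "norm (deriv k 0) * t \<le> - 2 * ln (norm z)"
        using norm_deriv_halfplane_le[OF holg neg] t Rek0 by (simp add: g_def norm_mult)
      then have "norm z * (norm (deriv k 0) * t) \<le> norm z * (- 2 * ln (norm z))"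
        by (intro mult_left_mono) auto
      then show ?thesis using t by (simp add: df norm_mult field_simps)
    qed
    then have "kobayashi_radius z \<le> - 2 * norm z * ln (norm z) / t"
      using z \<delta> by (intro kobayashi_radius_le) auto
    then show ?thesis using t z by (simp add: cusp_height_def field_simps)
  qed
  then show ?thesis using \<delta> by blast
qed

section \<open>Taylor remainders and logarithms in Landau notation\<close>

text \<open>Splitting off the factor z twice leaves a holomorphic cofactor of z^2, which is bounded
  near 0.\<close>

lemma holomorphic_quadratic_remainder:
  fixes f :: "complex \<Rightarrow> complex"
  assumes f: "f holomorphic_on ball 0 r" "0 < r" and d: "(f has_field_derivative d) (at 0)"
  shows "(\<lambda>z. f z - f 0 - d * z) \<in> O[at 0](\<lambda>z. z\<^sup>2)"
proof -
  have "(\<lambda>z. f z - f 0) holomorphic_on ball 0 r" by (intro holomorphic_intros f)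
  from Schwarz3[OF this] obtain h where h: "h holomorphic_on ball 0 r"
    "\<And>z. norm z < r \<Longrightarrow> f z - f 0 = z * h z" "deriv (\<lambda>z. f z - f 0) 0 = h 0"
    by auto
  have "((\<lambda>z. f z - f 0) has_field_derivative d) (at 0)"
    using d by (auto intro!: derivative_eq_intros)
  then have h0: "h 0 = d" using h(3) DERIV_imp_deriv by metis
  have "(\<lambda>z. h z - h 0) holomorphic_on ball 0 r" by (intro holomorphic_intros h)
  from Schwarz3[OF this] obtain k where k: "k holomorphic_on ball 0 r"
    "\<And>z. norm z < r \<Longrightarrow> h z - h 0 = z * k z" by auto
  have eq: "f z - f 0 - d * z = z\<^sup>2 * k z" if "norm z < r" for z
  proof -
    have "f z - f 0 - d * z = z * (h z - h 0)"
      using h(2)[OF that] h0 by (simp add: algebra_simps)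
    then show ?thesis by (simp add: k(2)[OF that] power2_eq_square)
  qed
  have "isCont k 0"
    using k(1) f(2) continuous_on_interior[of "ball 0 r" k 0] holomorphic_on_imp_continuous_on by auto
  then have "k \<in> O[at 0](\<lambda>_. 1)"
    by (intro bigoI_tendsto[where c = "k 0"]) (auto simp: isCont_def)
  from landau_o.big.mult[OF landau_o.big_refl[of "\<lambda>z. z\<^sup>2"] this]
  have "(\<lambda>z. z\<^sup>2 * k z) \<in> O[at 0](\<lambda>z. z\<^sup>2)" by simp
  moreover have "eventually (\<lambda>z. z \<in> ball 0 r) (at 0)"
    using f(2) by (intro eventually_at_in_open') auto
  then have "eventually (\<lambda>z. f z - f 0 - d * z = z\<^sup>2 * k z) (at 0)"
    by eventually_elim (use eq in auto)
  ultimately show ?thesis by (simp add: landau_o.big.in_cong)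
qed

lemma Re_holomorphic_quadratic_remainder:
  fixes f :: "complex \<Rightarrow> complex"
  assumes "f holomorphic_on ball 0 r" "0 < r" "(f has_field_derivative d) (at 0)"
  shows "(\<lambda>z. Re (f z) - Re (f 0) - Re (d * z)) \<in> O[at 0](\<lambda>z. (norm z)\<^sup>2)"
proof -
  have "(\<lambda>z. Re (f z) - Re (f 0) - Re (d * z)) \<in> O[at 0](\<lambda>z. norm (f z - f 0 - d * z))"
  proof (intro bigoI[of _ 1] always_eventually allI)
    fix z
    show "norm (Re (f z) - Re (f 0) - Re (d * z)) \<le> 1 * norm (norm (f z - f 0 - d * z))"
      using abs_Re_le_cmod[of "f z - f 0 - d * z"] by simp
  qed
  also have "(\<lambda>z. norm (f z - f 0 - d * z)) \<in> O[at 0](\<lambda>z. norm (z\<^sup>2))"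
    using holomorphic_quadratic_remainder[OF assms] by simp
  finally show ?thesis by (simp add: norm_power)
qed

lemma bigo_imp_tendsto_0:
  assumes "f \<in> O[F](g)" "(g \<longlongrightarrow> 0) F"
  shows "(f \<longlongrightarrow> 0) F"
proof -
  obtain C where "eventually (\<lambda>x. norm (f x) \<le> C * norm (g x)) F"
    using assms(1) by (rule landau_o.bigE)
  moreover have "((\<lambda>x. C * norm (g x)) \<longlongrightarrow> 0) F"
    using tendsto_mult_right_zero[OF tendsto_norm_zero[OF assms(2)]] .
  ultimately show ?thesis by (rule Lim_null_comparison)
qed

lemma bigo_ln_one_plus:
  fixes x :: "'a \<Rightarrow> real"
  assumes "(x \<longlongrightarrow> 0) F"
  shows "(\<lambda>z. ln (1 + x z) - x z) \<in> O[F](\<lambda>z. (x z)\<^sup>2)"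
proof (rule bigoI[of _ 2])
  have "eventually (\<lambda>z. dist (x z) 0 < 1 / 2) F" by (rule tendstoD[OF assms]) auto
  then show "eventually (\<lambda>z. norm (ln (1 + x z) - x z) \<le> 2 * norm ((x z)\<^sup>2)) F"
    by eventually_elim (use abs_ln_one_plus_x_minus_x_bound in auto)
qed

lemma bigo_ln_one_plus':
  fixes x :: "'a \<Rightarrow> real"
  assumes x: "x \<in> O[F](g)" and lim: "(x \<longlongrightarrow> 0) F"
  shows "(\<lambda>z. ln (1 + x z)) \<in> O[F](g)"
proof -
  have "x \<in> O[F](\<lambda>_. 1)" using lim by (intro bigoI_tendsto[where c = 0]) auto
  from landau_o.big.mult[OF x this] have "(\<lambda>z. (x z)\<^sup>2) \<in> O[F](g)"
    by (simp add: power2_eq_square)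
  with bigo_ln_one_plus[OF lim] have "(\<lambda>z. ln (1 + x z) - x z) \<in> O[F](g)"
    by (rule landau_o.big_trans)
  from sum_in_bigo(1)[OF this x] show ?thesis by simp
qed

lemma filterlim_minus_ln_norm: "filterlim (\<lambda>z :: complex. - ln (norm z)) at_top (at 0)"
proof -
  have "filterlim (\<lambda>z :: complex. norm z) (at_right 0) (at 0)"
    unfolding filterlim_at by (auto intro!: tendsto_eq_intros simp: eventually_at_filter)
  from filterlim_compose[OF ln_at_0 this] show ?thesis
    by (simp add: filterlim_uminus_at_top)
qed

section \<open>From the functional equation to the first-order expansion\<close>

text \<open>Summing the increments of \<open>u\<close> along the iterates of \<open>T\<close> leaves
  a series dominated by a geometric one, while \<open>u\<close> itself dies out at 0. The sum is
  never formed: \<open>v\<close> does not decrease along the orbit and tends to 0, so it starts at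
  most at 0.\<close>

lemma le_square_of_Landen_contraction:
  fixes u :: "complex \<Rightarrow> real"
  assumes C: "0 \<le> C" and \<delta>: "0 < \<delta>" "\<delta> \<le> 1 / 2"
    and T: "\<And>z. z \<noteq> 0 \<Longrightarrow> T z \<noteq> 0" "\<And>z. norm (T z) \<le> (norm z)\<^sup>2"
    and u: "\<And>z. z \<noteq> 0 \<Longrightarrow> norm z < \<delta> \<Longrightarrow> \<bar>u z - u (T z)\<bar> \<le> C * (norm z)\<^sup>2"
    and lim: "(u \<longlongrightarrow> 0) (at 0)"
    and z: "z \<noteq> 0" "norm z < \<delta>"
  shows "\<bar>u z\<bar> \<le> 2 * C * (norm z)\<^sup>2"
proof -
  \<comment> \<open>The factor 2 makes \<open>v\<close> monotone: C |z|^2 + 2 C |T z|^2 <= 2 C |z|^2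
    as soon as 2 |T z|^2 <= |z|^2.\<close>
  define v where "v = (\<lambda>z. \<bar>u z\<bar> - 2 * C * (norm z)\<^sup>2)"
  have half: "norm (T z) \<le> norm z / 2" if "norm z < \<delta>" for z
  proof -
    have "norm (T z) \<le> norm z * norm z" using T(2)[of z] by (simp add: power2_eq_square)
    also have "\<dots> \<le> norm z * (1 / 2)" using that \<delta> by (intro mult_left_mono) auto
    finally show ?thesis by simp
  qed
  have step: "v z \<le> v (T z)" if "z \<noteq> 0" "norm z < \<delta>" for z
  proof -
    have "(norm (T z))\<^sup>2 \<le> (norm z / 2)\<^sup>2" using half[OF that(2)] by (intro power_mono) auto
    then have "4 * (norm (T z))\<^sup>2 \<le> (norm z)\<^sup>2" by (simp add: power_divide)
    then have "2 * (norm (T z))\<^sup>2 \<le> (norm z)\<^sup>2"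
      using zero_le_power2[of "norm (T z)"] by linarith
    then have "C * (2 * (norm (T z))\<^sup>2) \<le> C * (norm z)\<^sup>2" by (intro mult_left_mono C)
    then show ?thesis using u[OF that] by (auto simp: v_def)
  qed
  define a where "a = (\<lambda>n. (T ^^ n) z)"
  have a: "a n \<noteq> 0 \<and> norm (a n) \<le> norm z / 2 ^ n \<and> norm (a n) < \<delta> \<and> v z \<le> v (a n)" for n
  proof (induction n)
    case 0
    then show ?case using z by (simp add: a_def)
  next
    case (Suc n)
    have "norm (a (Suc n)) \<le> norm (a n) / 2" using half Suc by (simp add: a_def)
    moreover from this have "norm (a (Suc n)) \<le> norm (a n)"
      using norm_ge_zero[of "a n"] by linarith
    ultimately show ?case using Suc step[of "a n"] T(1)[of "a n"] by (auto simp: a_def)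
  qed
  have "(\<lambda>n. norm z / 2 ^ n) \<longlonglongrightarrow> 0"
    by (intro LIMSEQ_divide_realpow_zero) auto
  then have "a \<longlonglongrightarrow> 0"
    by (rule Lim_null_comparison[rotated]) (use a in auto)
  then have "filterlim a (at 0) sequentially"
    unfolding filterlim_at using a by (auto intro!: always_eventually)
  moreover have "(v \<longlongrightarrow> 0) (at 0)"
    unfolding v_def by (auto intro!: tendsto_eq_intros lim)
  ultimately have "(\<lambda>n. v (a n)) \<longlonglongrightarrow> 0" by (rule filterlim_compose[rotated])
  then have "v z \<le> 0" by (rule tendsto_lowerbound) (use a in auto)
  then show ?thesis by (simp add: v_def)
qed

text \<open>An approximate solution of the functional equation. The square root reproduces the
  factor in \<open>cusp_height_Landen\<close>, ln 16 is the fixed point forced by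
  \<open>Landen z\<close> ~ z^2 / 16, and the term -Re z / 2 absorbs the linear term of ln |1 +
  csqrt (1 - z)|.\<close>

definition cusp_model :: "complex \<Rightarrow> real" where
  "cusp_model z = sqrt (norm (1 - z)) * (ln 16 - ln (norm z) - Re z / 2)"

lemma cusp_height_asymp: "((\<lambda>z. cusp_height z / - ln (norm z)) \<longlongrightarrow> 1) (at 0)"
proof (rule tendstoI)
  fix e :: real assume e: "e > 0"
  define t where "t = 1 / (1 + e / 2)"
  have t: "0 < t" "t < 1" using e by (auto simp: t_def)
  obtain \<delta> where \<delta>: "\<delta> > 0" "\<delta> < 1" "\<And>z. z \<noteq> 0 \<and> norm z < \<delta> \<Longrightarrow> t * cusp_height z \<le> - ln (norm z)"
    using cusp_height_le[OF t] by blast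
  have "eventually (\<lambda>z :: complex. z \<in> ball 0 \<delta> - {0}) (at 0)"
    using \<delta> by (intro eventually_at_in_open) auto
  then show "eventually (\<lambda>z. dist (cusp_height z / - ln (norm z)) 1 < e) (at 0)"
  proof eventually_elim
    case (elim z)
    define l where "l = - ln (norm z)"
    have l: "l > 0" using elim \<delta> by (simp add: l_def)
    have "cusp_height z / (1 + e / 2) \<le> l" using \<delta>(3)[of z] elim by (simp add: t_def l_def)
    then have "cusp_height z \<le> l * (1 + e / 2)" using e by (simp add: divide_le_eq)
    then have "cusp_height z / l \<le> 1 + e / 2" using l by (simp add: divide_le_eq mult.commute)
    moreover have "1 \<le> cusp_height z / l"
      using cusp_height_ge[of z] elim \<delta>(2) l by (simp add: l_def[symmetric])
    ultimately show ?case using e unfolding l_def[symmetric] by (simp add: dist_real_def)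
  qed
qed

lemma cusp_model_asymp: "((\<lambda>z. cusp_model z / - ln (norm z)) \<longlongrightarrow> 1) (at 0)"
proof -
  have inv: "((\<lambda>z :: complex. 1 / - ln (norm z)) \<longlongrightarrow> 0) (at 0)"
    using tendsto_inverse_0_at_top[OF filterlim_minus_ln_norm] by (simp add: inverse_eq_divide)
  have "((\<lambda>z. sqrt (norm (1 - z)) * ((ln 16 - Re z / 2) * (1 / - ln (norm z)) + 1)) \<longlongrightarrow>
          sqrt (norm (1 - 0 :: complex)) * ((ln 16 - Re 0 / 2) * 0 + 1)) (at 0)"
    by (intro tendsto_intros inv) simp_all
  moreover have "eventually (\<lambda>z :: complex. 0 < - ln (norm z)) (at 0)"
    using filterlim_minus_ln_norm unfolding filterlim_at_top_dense by blast
  then have "eventually (\<lambda>z. sqrt (norm (1 - z)) * ((ln 16 - Re z / 2) * (1 / - ln (norm z)) + 1)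
       = cusp_model z / - ln (norm z)) (at 0)"
    by eventually_elim (simp add: cusp_model_def field_simps)
  ultimately show ?thesis by (simp add: tendsto_cong)
qed

text \<open>Taking logarithms turns the functional equation of \<open>cusp_height\<close> into an additive one, which
  \<open>cusp_model\<close> satisfies up to a quadratic error. The first-order behaviour, where the two agree, is
  then propagated along the rapidly converging Landen iteration.\<close>

lemma cusp_height_expansion:
  "(\<lambda>z. ln (cusp_height z) - ln (cusp_model z)) \<in> O[at 0](\<lambda>z. (norm z)\<^sup>2)"
proof -
  define u where "u = (\<lambda>z. ln (cusp_height z) - ln (cusp_model z))"
  \<comment> \<open>\<open>N z\<close> is twice the bracket in \<open>cusp_model z\<close>, and
    \<open>D z\<close> is the bracket in \<open>cusp_model (Landen z)\<close>. The model satisfies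
    the functional equation to the extent that \<open>N\<close> and \<open>D\<close> agree.\<close>
  define N where "N = (\<lambda>z :: complex. 2 * ln 16 - 2 * ln (norm z) - Re z)"
  define D where "D = (\<lambda>z. ln 16 - ln (norm (Landen z)) - Re (Landen z) / 2)"
  let ?Q = "\<lambda>z :: complex. (norm z)\<^sup>2 :: real"
  have limQ: "(?Q \<longlongrightarrow> 0) (at 0)" by (auto intro!: tendsto_eq_intros)
  have ev_small: "eventually (\<lambda>z :: complex. z \<in> ball 0 (1/2) - {0}) (at 0)"
    by (intro eventually_at_in_open) auto
  have pos_l: "eventually (\<lambda>z :: complex. 0 < - ln (norm z)) (at 0)"
    using filterlim_minus_ln_norm unfolding filterlim_at_top_dense by blast
  have limN: "filterlim N at_top (at 0)"
  proof (rule filterlim_at_top_mono[OF filterlim_minus_ln_norm])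
    show "eventually (\<lambda>z. - ln (norm z) \<le> N z) (at 0)"
      using ev_small pos_l
    proof eventually_elim
      case (elim z)
      have "ln 16 \<ge> (0 :: real)" by simp
      moreover have "Re z \<le> 1 / 2" using elim complex_Re_le_cmod[of z] by simp
      moreover have "ln 16 \<ge> (1 :: real)"
        using exp_le ln_le_cancel_iff[of "exp 1" "16 :: real"] by simp
      ultimately show ?case using elim(2) unfolding N_def by linarith
    qed
  qed
  have limL: "(Landen \<longlongrightarrow> 0) (at 0)"
    by (rule Lim_null_comparison[OF _ limQ]) (auto intro!: always_eventually norm_Landen_le)
  have Lbig: "(\<lambda>z. norm (Landen z)) \<in> O[at 0](?Q)"
    using norm_Landen_le by (intro bigoI[of _ 1]) (auto intro!: always_eventually)
  have LlimL: "filterlim Landen (at 0) (at 0)"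
    unfolding filterlim_at using limL by (auto simp: eventually_at_filter)
  have holk: "(\<lambda>z. Ln (1 + csqrt (1 - z))) holomorphic_on ball 0 1"
  proof (intro holomorphic_intros)
    fix z :: complex assume "z \<in> ball 0 1"
    then have "Re (1 - z) > 0" using complex_Re_le_cmod[of z] by simp
    then show "1 - z \<notin> \<real>\<^sub>\<le>\<^sub>0" by (auto simp: complex_nonpos_Reals_iff)
    have "Re (1 + csqrt (1 - z)) > 0"
      using csqrt_principal[of "1 - z"] by (auto simp del: csqrt.simps)
    then show "1 + csqrt (1 - z) \<notin> \<real>\<^sub>\<le>\<^sub>0" by (auto simp: complex_nonpos_Reals_iff)
  qed
  have "((\<lambda>z. Ln (1 + csqrt (1 - z))) has_field_derivative - 1 / 4) (at 0)"
    by (auto intro!: derivative_eq_intros)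
  from Re_holomorphic_quadratic_remainder[OF holk _ this]
  have "(\<lambda>z. Re (Ln (1 + csqrt (1 - z))) - ln 2 + Re z / 4) \<in> O[at 0](?Q)"
    by simp
  \<comment> \<open>The factor -4 comes from ln |Landen z| = 2 ln |z| - 4 ln |1 + csqrt (1 - z)|.
    The constants then match since ln 16 = 4 ln 2, and the linear terms cancel.\<close>
  then have "(\<lambda>z. -4 * (Re (Ln (1 + csqrt (1 - z))) - ln 2 + Re z / 4)) \<in> O[at 0](?Q)"
    by (subst landau_o.big.cmult_in_iff) simp_all
  moreover have "(\<lambda>z. Re (Landen z) / 2) \<in> O[at 0](\<lambda>z. norm (Landen z))"
  proof (intro bigoI[of _ 1] always_eventually allI)
    show "norm (Re (Landen z) / 2) \<le> 1 * norm (norm (Landen z))" for z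
      using abs_Re_le_cmod[of "Landen z"] by simp
  qed
  then have "(\<lambda>z. Re (Landen z) / 2) \<in> O[at 0](?Q)"
    using Lbig landau_o.big_trans by blast
  ultimately have
    "(\<lambda>z. -4 * (Re (Ln (1 + csqrt (1 - z))) - ln 2 + Re z / 4) + Re (Landen z) / 2) \<in> O[at 0](?Q)"
    by (rule sum_in_bigo)
  moreover have "eventually (\<lambda>z. -4 * (Re (Ln (1 + csqrt (1 - z))) - ln 2 + Re z / 4) + Re (Landen z) / 2
      = N z - D z) (at 0)"
    using ev_small
  proof eventually_elim
    case (elim z)
    define k where "k = 1 + csqrt (1 - z)"
    have "1 \<le> norm k" unfolding k_def by (rule one_plus_csqrt_norm)
    then have k: "k \<noteq> 0" by auto
    have "norm (Landen z) = (norm z / (norm k)\<^sup>2)\<^sup>2"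
      by (simp add: Landen_def k_def norm_power norm_divide)
    also have "ln \<dots> = 2 * (ln (norm z) - 2 * ln (norm k))"
      using elim k by (simp add: ln_realpow ln_div)
    finally have "ln (norm (Landen z)) = 2 * (ln (norm z) - 2 * ln (norm k))" .
    moreover have "ln 16 = 4 * ln (2 :: real)" using ln_realpow[of 2 4] by simp
    ultimately show ?case
      using k by (simp add: N_def D_def k_def[symmetric])
  qed
  ultimately have ND: "(\<lambda>z. N z - D z) \<in> O[at 0](?Q)" by (simp add: landau_o.big.in_cong)
  have "((\<lambda>z. 1 / N z) \<longlongrightarrow> 0) (at 0)"
    using tendsto_inverse_0_at_top[OF limN] by (simp add: inverse_eq_divide)
  then have "(\<lambda>z. 1 / N z) \<in> O[at 0](\<lambda>_. 1)" by (intro bigoI_tendsto[where c = 0]) auto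
  \<comment> \<open>Dividing by \<open>N\<close>, which tends to infinity, does not spoil the
    estimate; 1 minus this quotient is D / N, whose logarithm is wanted.\<close>
  from landau_o.big.mult[OF ND this] have r: "(\<lambda>z. (N z - D z) / N z) \<in> O[at 0](?Q)" by simp
  have rlim: "((\<lambda>z. (N z - D z) / N z) \<longlongrightarrow> 0) (at 0)"
    by (rule bigo_imp_tendsto_0[OF r limQ])
  have evN: "eventually (\<lambda>z. 0 < N z) (at 0)"
    using limN unfolding filterlim_at_top_dense by blast
  have "((\<lambda>z. 1 - (N z - D z) / N z) \<longlongrightarrow> 1 - 0) (at 0)" by (intro tendsto_intros rlim)
  then have "eventually (\<lambda>z. 0 < 1 - (N z - D z) / N z) (at 0)"
    by (rule order_tendstoD) simp
  with evN have evD: "eventually (\<lambda>z. 0 < D z) (at 0)"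
    by eventually_elim (auto simp: diff_divide_distrib zero_less_divide_iff)
  have DN: "(\<lambda>z. ln (1 + - ((N z - D z) / N z))) \<in> O[at 0](?Q)"
    using r tendsto_minus[OF rlim] by (intro bigo_ln_one_plus') simp_all
  have "(\<lambda>z. norm (1 - Landen z) - 1) \<in> O[at 0](\<lambda>z. norm (Landen z))"
  proof (intro bigoI[of _ 1] always_eventually allI)
    show "norm (norm (1 - Landen z) - 1) \<le> 1 * norm (norm (Landen z))" for z
      using norm_triangle_ineq3[of "1 - Landen z" 1] by simp
  qed
  then have L1: "(\<lambda>z. norm (1 - Landen z) - 1) \<in> O[at 0](?Q)"
    using Lbig landau_o.big_trans by blast
  have "(\<lambda>z. ln (1 + (norm (1 - Landen z) - 1))) \<in> O[at 0](?Q)"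
    by (intro bigo_ln_one_plus' L1 bigo_imp_tendsto_0[OF L1 limQ])
  then have "(\<lambda>z. ln (norm (1 - Landen z)) / 2) \<in> O[at 0](?Q)" by simp
  from sum_in_bigo(1)[OF this DN]
  have "(\<lambda>z. ln (norm (1 - Landen z)) / 2 + ln (1 + - ((N z - D z) / N z))) \<in> O[at 0](?Q)" .
  moreover have "eventually (\<lambda>z. ln (norm (1 - Landen z)) / 2 + ln (1 + - ((N z - D z) / N z))
      = u z - u (Landen z)) (at 0)"
    using ev_small evN evD
  proof eventually_elim
    case (elim z)
    have z: "z \<noteq> 0" "norm z < 1 / 2" "z \<noteq> 1" using elim by auto
    have "norm (Landen z) \<le> norm z * norm z" using norm_Landen_le[of z] by (simp add: power2_eq_square)
    also have "\<dots> \<le> norm z * 1" using z by (intro mult_left_mono) auto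
    finally have Lz: "Landen z \<noteq> 0" "norm (Landen z) < 1" "Landen z \<noteq> 1" using z by auto
    have "ln (norm (Landen z)) < 0" using Lz by simp
    then have hL: "cusp_height (Landen z) > 0" using cusp_height_ge[of "Landen z"] Lz by linarith
    have "ln (cusp_height z) = ln (sqrt (norm (1 - z))) - ln 2 + ln (cusp_height (Landen z))"
      using z hL by (subst cusp_height_Landen) (simp_all add: ln_mult ln_div)
    moreover have "ln (cusp_model z) = ln (sqrt (norm (1 - z))) + ln (N z) - ln 2"
    proof -
      have "cusp_model z = sqrt (norm (1 - z)) * (N z / 2)"
        by (simp add: cusp_model_def N_def diff_divide_distrib)
      also have "ln \<dots> = ln (sqrt (norm (1 - z))) + (ln (N z) - ln 2)"
        using z elim by (subst ln_mult) (simp_all add: ln_div)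
      finally show ?thesis by simp
    qed
    moreover have "ln (cusp_model (Landen z)) = ln (norm (1 - Landen z)) / 2 + ln (D z)"
    proof -
      have "cusp_model (Landen z) = sqrt (norm (1 - Landen z)) * D z"
        by (simp add: cusp_model_def D_def)
      then show ?thesis using Lz elim by (simp add: ln_mult ln_sqrt)
    qed
    moreover have "1 + - ((N z - D z) / N z) = D z / N z" using elim by (simp add: field_simps)
    ultimately show ?case using elim by (simp add: u_def ln_div)
  qed
  ultimately have "(\<lambda>z. u z - u (Landen z)) \<in> O[at 0](?Q)" by (simp add: landau_o.big.in_cong)
  then obtain C where C: "C > 0" "eventually (\<lambda>z. norm (u z - u (Landen z)) \<le> C * norm (?Q z)) (at 0)"
    by (rule landau_o.bigE)
  from C(2) obtain d where d: "d > 0"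
    "\<And>z. z \<noteq> 0 \<Longrightarrow> norm z < d \<Longrightarrow> \<bar>u z - u (Landen z)\<bar> \<le> C * (norm z)\<^sup>2"
    unfolding eventually_at by (auto simp: dist_norm)
  have pos_h: "eventually (\<lambda>z. 0 < cusp_height z / - ln (norm z)) (at 0)"
    by (rule order_tendstoD(1)[OF cusp_height_asymp]) simp
  have pos_m: "eventually (\<lambda>z. 0 < cusp_model z / - ln (norm z)) (at 0)"
    by (rule order_tendstoD(1)[OF cusp_model_asymp]) simp
  \<comment> \<open>Both heights are asymptotic to - ln |z|, so the logarithm of their quotient
    tends to 0 although their difference is not controlled.\<close>
  have "((\<lambda>z. ln (cusp_height z / - ln (norm z)) - ln (cusp_model z / - ln (norm z))) \<longlongrightarrow> ln 1 - ln 1) (at 0)"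
    by (intro tendsto_intros cusp_height_asymp cusp_model_asymp) simp_all
  moreover have "eventually (\<lambda>z. ln (cusp_height z / - ln (norm z)) - ln (cusp_model z / - ln (norm z)) = u z) (at 0)"
    using pos_h pos_m pos_l
  proof eventually_elim
    case (elim z)
    define l where "l = - ln (norm z)"
    have "0 < cusp_height z" "0 < cusp_model z" "0 < l"
      using elim unfolding l_def[symmetric] by (simp_all add: zero_less_divide_iff)
    then show ?case unfolding l_def[symmetric] u_def by (simp add: ln_div)
  qed
  ultimately have "(u \<longlongrightarrow> 0) (at 0)" by (simp add: tendsto_cong)
  then have "\<bar>u z\<bar> \<le> 2 * C * (norm z)\<^sup>2" if "z \<noteq> 0" "norm z < min d (1 / 2)" for z
    using that d C(1) norm_Landen_le
    by (intro le_square_of_Landen_contraction[of C "min d (1 / 2)" Landen]) auto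
  moreover have "eventually (\<lambda>z :: complex. z \<in> ball 0 (min d (1 / 2)) - {0}) (at 0)"
    using d(1) by (intro eventually_at_in_open) auto
  ultimately have "eventually (\<lambda>z. norm (u z) \<le> 2 * C * norm (?Q z)) (at 0)"
    by (auto elim!: eventually_mono)
  then show ?thesis unfolding u_def by (rule bigoI)
qed

subsection \<open>Coverings of the punctured projective line\<close>

text \<open>Every disc lifts to the half plane, where the Schwarz lemma bounds its derivative by 2
  Im \<tau>; the Cayley parametrisation of the half plane centred at \<tau> attains the
  bound.\<close>

lemma kobayashi_radius_covering:
  assumes cov: "covering_space upper_half_plane \<phi> (- {0, 1})"
    and hol: "\<phi> holomorphic_on upper_half_plane" and \<tau>: "\<tau> \<in> upper_half_plane"
  shows "kobayashi_radius (\<phi> \<tau>) = 2 * norm (deriv \<phi> \<tau>) * Im \<tau>"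
proof (rule antisym)
  have op: "open upper_half_plane" unfolding upper_half_plane_def by (rule open_halfspace_Im_gt)
  have im: "\<phi> ` upper_half_plane = - {0, 1}" using cov by (rule covering_space_imp_surjective)
  have d\<phi>: "(\<phi> has_field_derivative deriv \<phi> \<tau>) (at \<tau>)"
    using hol op \<tau> by (rule holomorphic_derivI)
  have Im\<tau>: "Im \<tau> > 0" using \<tau> by (simp add: upper_half_plane_def)
  show "kobayashi_radius (\<phi> \<tau>) \<le> 2 * norm (deriv \<phi> \<tau>) * Im \<tau>"
  proof (rule kobayashi_radius_le)
    have "\<phi> \<tau> \<in> - {0, 1}" using im \<tau> by blast
    then show "\<phi> \<tau> \<noteq> 0" "\<phi> \<tau> \<noteq> 1" by auto
    fix f assume f: "f \<in> disc_maps (\<phi> \<tau>)"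
    have holf: "f holomorphic_on ball 0 1" and fim: "f \<in> ball 0 1 \<rightarrow> - {0, 1}" and f0: "f 0 = \<phi> \<tau>"
      using f by (auto simp: disc_maps_def)
    obtain g where g: "continuous_on (ball 0 1) g" "g \<in> ball 0 1 \<rightarrow> upper_half_plane" "g 0 = \<tau>"
      "\<And>y. y \<in> ball 0 1 \<Longrightarrow> \<phi> (g y) = f y"
      using covering_space_lift_strong[OF cov \<tau> centre_in_ball[THEN iffD2, OF zero_less_one]
          convex_imp_simply_connected[OF convex_ball]
          convex_imp_locally_path_connected[OF convex_ball]
          holomorphic_on_imp_continuous_on[OF holf] fim f0] by blast
    have holg: "g holomorphic_on ball 0 1"
      by (rule covering_space_lift_is_holomorphic[OF cov op hol holf fim g(2,1,4)])
    \<comment> \<open>Multiplication by i rotates the upper half plane to the left one, where the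
      derivative bound was proved.\<close>
    have "Re (\<i> * g z) < 0" if "norm z < 1" for z
      using g(2) that by (auto simp: upper_half_plane_def Pi_iff)
    with holg have "norm (deriv (\<lambda>z. \<i> * g z) 0) \<le> - 2 * Re (\<i> * g 0)"
      by (intro norm_deriv_halfplane_le holomorphic_intros)
    moreover have dg: "(g has_field_derivative deriv g 0) (at 0)"
      using holg by (intro holomorphic_derivI[of _ "ball 0 1"]) auto
    have "deriv (\<lambda>z. \<i> * g z) 0 = \<i> * deriv g 0"
      by (intro DERIV_imp_deriv DERIV_cmult dg)
    ultimately have "norm (deriv g 0) \<le> 2 * Im \<tau>" by (simp add: norm_mult g(3))
    moreover have "deriv f 0 = deriv \<phi> \<tau> * deriv g 0"
    proof (rule DERIV_imp_deriv, rule has_field_derivative_transform_within_open[of _ _ _ "ball 0 1"])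
      show "((\<lambda>z. \<phi> (g z)) has_field_derivative deriv \<phi> \<tau> * deriv g 0) (at 0)"
        using DERIV_chain'[OF dg, of \<phi> "deriv \<phi> \<tau>"] d\<phi> by (simp add: g(3) mult.commute)
    qed (use g(4) in auto)
    ultimately show "norm (deriv f 0) \<le> 2 * norm (deriv \<phi> \<tau>) * Im \<tau>"
      using mult_left_mono[of "norm (deriv g 0)" "2 * Im \<tau>" "norm (deriv \<phi> \<tau>)"]
      by (simp add: norm_mult mult_ac)
  qed
  define k where "k = (\<lambda>z :: complex. of_real (Re \<tau>) + \<i> * of_real (Im \<tau>) * ((1 + z) / (1 - z)))"
  have nz: "1 - z \<noteq> 0" if "norm z < 1" for z :: complex using that by auto
  have holk: "k holomorphic_on ball 0 1"
    unfolding k_def using nz by (intro holomorphic_intros) auto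
  have k0: "k 0 = \<tau>" by (simp add: k_def complex_eq_iff)
  have imk: "k z \<in> upper_half_plane" if "norm z < 1" for z
    using mult_pos_pos[OF Im\<tau> Re_Cayley_pos[OF that]]
    by (simp add: k_def upper_half_plane_def mult.assoc del: times_divide_eq_right)
  have "((\<lambda>z. (1 + z) / (1 - z)) has_field_derivative 2) (at (0 :: complex))"
    by (auto intro!: derivative_eq_intros)
  from DERIV_cmult[OF this, of "\<i> * of_real (Im \<tau>)"]
  have dk: "(k has_field_derivative \<i> * of_real (Im \<tau>) * 2) (at 0)"
    unfolding k_def by (auto intro!: derivative_eq_intros)
  have "(\<phi> \<circ> k) holomorphic_on ball 0 1"
    using imk by (intro holomorphic_on_compose_gen[OF holk hol]) auto
  moreover have "(\<phi> \<circ> k) ` ball 0 1 \<subseteq> - {0, 1}"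
  proof (intro image_subsetI)
    fix z :: complex assume "z \<in> ball 0 1"
    then have "\<phi> (k z) \<in> \<phi> ` upper_half_plane" using imk[of z] by simp
    then show "(\<phi> \<circ> k) z \<in> - {0, 1}" using im by simp
  qed
  ultimately have "\<phi> \<circ> k \<in> disc_maps (\<phi> \<tau>)" by (simp add: disc_maps_def k0)
  moreover have "deriv (\<phi> \<circ> k) 0 = deriv \<phi> \<tau> * (\<i> * of_real (Im \<tau>) * 2)"
    using d\<phi> dk k0 by (intro DERIV_imp_deriv DERIV_chain) simp_all
  ultimately show "2 * norm (deriv \<phi> \<tau>) * Im \<tau> \<le> kobayashi_radius (\<phi> \<tau>)"
    using norm_deriv_le_kobayashi_radius[of "\<phi> \<circ> k" "\<phi> \<tau>"] Im\<tau> by (simp add: norm_mult mult_ac)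
qed

lemma covering_space_homeomorphism_compose:
  assumes cov: "covering_space C p S" and hom: "homeomorphism S S' m n"
  shows "covering_space C (m \<circ> p) S'"
proof
  have p: "continuous_on C p" "p ` C = S"
    using cov by (auto dest: covering_space_imp_continuous covering_space_imp_surjective)
  have m: "continuous_on S m" "m ` S = S'" "n ` S' = S" "\<And>x. x \<in> S \<Longrightarrow> n (m x) = x" "\<And>y. y \<in> S' \<Longrightarrow> m (n y) = y"
    using hom by (auto simp: homeomorphism_def)
  show "continuous_on C (m \<circ> p)" using p m by (intro continuous_on_compose) simp_all
  show "(m \<circ> p) ` C = S'" using p m by (metis image_comp)
  fix y assume y: "y \<in> S'"
  then have "n y \<in> S" using m by blast
  then obtain T v where T: "n y \<in> T" "openin (top_of_set S) T"
    and v: "\<Union>v = C \<inter> p -` T" "\<forall>u\<in>v. openin (top_of_set C) u" "pairwise disjnt v"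
      "\<forall>u\<in>v. \<exists>q. homeomorphism u T p q"
    using cov unfolding covering_space_def by meson
  have TS: "T \<subseteq> S" using T(2) by (rule openin_imp_subset)
  have homT: "homeomorphism T (m ` T) m n"
    using hom TS by (auto intro: homeomorphism_of_subsets)
  have "\<Union>v = C \<inter> (m \<circ> p) -` (m ` T)"
  proof -
    have "p x \<in> T \<longleftrightarrow> m (p x) \<in> m ` T" if "x \<in> C" for x
    proof
      assume "m (p x) \<in> m ` T"
      then obtain s where s: "s \<in> T" "m (p x) = m s" by auto
      have "p x \<in> S" using p that by blast
      then have "p x = s" using m(4)[of "p x"] m(4)[of s] s TS by auto
      then show "p x \<in> T" using s by simp
    qed simp
    then show ?thesis using v(1) by auto
  qed
  moreover have "\<forall>u\<in>v. \<exists>q. homeomorphism u (m ` T) (m \<circ> p) q"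
    using v(4) homT homeomorphism_compose by blast
  moreover have "y \<in> m ` T" using T(1) m(5)[OF y] by (metis imageI)
  moreover have "openin (top_of_set S') (m ` T)"
    by (rule homeomorphism_imp_open_map[OF hom T(2)])
  ultimately show "\<exists>T. y \<in> T \<and> openin (top_of_set S') T \<and>
      (\<exists>v. \<Union>v = C \<inter> (m \<circ> p) -` T \<and> (\<forall>u\<in>v. openin (top_of_set C) u) \<and>
        pairwise disjnt v \<and> (\<forall>u\<in>v. \<exists>q. homeomorphism u T (m \<circ> p) q))"
    using v(2,3) by blast
qed

section \<open>Points, topology and charts of the projective line\<close>

lemma proportional_refl: "x \<noteq> 0 \<Longrightarrow> proportional x x"
  by (auto simp: proportional_def intro!: exI[of _ 1])

lemma abs_cp1_eq_iff: "x \<noteq> 0 \<Longrightarrow> y \<noteq> 0 \<Longrightarrow> abs_cp1 x = abs_cp1 y \<longleftrightarrow> proportional x y"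
  using Quotient3_rel[OF Quotient3_cp1, of x y] by (simp add: proportional_refl)

lemma abs_cp1_cases: obtains x where "x \<noteq> 0" "P = abs_cp1 x"
  using Quotient3_abs_rep[OF Quotient3_cp1, of P] Quotient3_rep_reflp[OF Quotient3_cp1, of P]
  unfolding proportional_def by metis

text \<open>The determinant criterion removes the scalar and treats the point at infinity like any
  other point.\<close>

lemma proportional_iff_det:
  assumes "x \<noteq> 0" "y \<noteq> 0"
  shows "proportional x y \<longleftrightarrow> fst x * snd y = fst y * snd x"
proof
  assume *: "fst x * snd y = fst y * snd x"
  show "proportional x y"
  proof (cases "fst x = 0")
    case True
    then have x: "snd x \<noteq> 0" using assms(1) by (simp add: prod_eq_iff)
    with * True have y: "fst y = 0" by simp
    then have "snd y \<noteq> 0" using assms(2) by (simp add: prod_eq_iff)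
    then show ?thesis
      unfolding proportional_def using assms True x y
      by (intro conjI exI[of _ "snd y / snd x"]) (simp_all add: prod_eq_iff)
  next
    case False
    have "fst y \<noteq> 0"
    proof
      assume "fst y = 0"
      then have "snd y = 0" using * False by simp
      with \<open>fst y = 0\<close> show False using assms(2) by (simp add: prod_eq_iff)
    qed
    moreover have "snd y = fst y / fst x * snd x" using * False by (simp add: field_simps)
    ultimately show ?thesis
      unfolding proportional_def using assms False
      by (intro conjI exI[of _ "fst y / fst x"]) (simp_all add: prod_eq_iff)
  qed
next
  assume "proportional x y"
  then obtain c where "y = (c * fst x, c * snd x)" by (auto simp: proportional_def)
  then show "fst x * snd y = fst y * snd x" by simp
qed

lemma abs_cp1_eq_affine_point_iff: "x \<noteq> 0 \<Longrightarrow> abs_cp1 x = affine_point a \<longleftrightarrow> fst x = a * snd x"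
  by (simp add: affine_point.abs_eq abs_cp1_eq_iff proportional_iff_det zero_prod_def)

lemma abs_cp1_eq_infinity_iff: "x \<noteq> 0 \<Longrightarrow> abs_cp1 x = cp1_infinity \<longleftrightarrow> snd x = 0"
  by (simp add: cp1_infinity.abs_eq abs_cp1_eq_iff proportional_iff_det zero_prod_def)

lemma open_Compl_affine_point: "open (- {affine_point a})"
proof -
  have "{x. x \<noteq> 0 \<and> abs_cp1 x \<in> - {affine_point a}} = {x. fst x \<noteq> a * snd x}"
  proof (intro Collect_cong)
    show "x \<noteq> 0 \<and> abs_cp1 x \<in> - {affine_point a} \<longleftrightarrow> fst x \<noteq> a * snd x" for x
      by (cases "x = 0") (simp_all add: abs_cp1_eq_affine_point_iff)
  qed
  also have "open \<dots>" by (intro open_Collect_neq continuous_intros)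
  finally show ?thesis by (simp add: open_cp1_def)
qed

lemma open_Compl_infinity: "open (- {cp1_infinity})"
proof -
  have "{x. x \<noteq> 0 \<and> abs_cp1 x \<in> - {cp1_infinity}} = {x :: complex \<times> complex. snd x \<noteq> 0}"
  proof (intro Collect_cong)
    show "x \<noteq> 0 \<and> abs_cp1 x \<in> - {cp1_infinity} \<longleftrightarrow> snd x \<noteq> 0" for x
      by (cases "x = 0") (simp_all add: abs_cp1_eq_infinity_iff)
  qed
  also have "open \<dots>" by (intro open_Collect_neq continuous_intros)
  finally show ?thesis by (simp add: open_cp1_def)
qed

text \<open>The Moebius transformation taking \<open>a1, a2, a3\<close> to \<open>0, 1, \<infinity>\<close>; it has the junk value
  0 at \<open>a3\<close>.\<close>

lift_definition to_cusps :: "complex \<Rightarrow> complex \<Rightarrow> complex \<Rightarrow> cp1 \<Rightarrow> complex" is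
  "\<lambda>a1 a2 a3 x. (fst x - a1 * snd x) * (a2 - a3) / ((fst x - a3 * snd x) * (a2 - a1))"
proof -
  fix a1 a2 a3 and x y assume "proportional x y"
  then obtain c where c: "c \<noteq> 0" "y = (c * fst x, c * snd x)" by (auto simp: proportional_def)
  have "fst y - a * snd y = c * (fst x - a * snd x)" for a
    using c by (simp add: algebra_simps)
  then show "(fst x - a1 * snd x) * (a2 - a3) / ((fst x - a3 * snd x) * (a2 - a1))
      = (fst y - a1 * snd y) * (a2 - a3) / ((fst y - a3 * snd y) * (a2 - a1))"
    using c(1) by (simp add: mult.assoc)
qed

text \<open>The solution of \<open>to_cusps a1 a2 a3 P = w\<close>, in homogeneous coordinates
  because P = \<open>cp1_infinity\<close> is an ordinary solution, for w = (a2 - a3) / (a2 -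
  a1).\<close>

definition from_cusps :: "complex \<Rightarrow> complex \<Rightarrow> complex \<Rightarrow> complex \<Rightarrow> cp1" where
  "from_cusps a1 a2 a3 w =
     abs_cp1 (a3 * w * (a2 - a1) - a1 * (a2 - a3), w * (a2 - a1) - (a2 - a3))"

lemma to_cusps_abs_cp1:
  "x \<noteq> 0 \<Longrightarrow> to_cusps a1 a2 a3 (abs_cp1 x) =
     (fst x - a1 * snd x) * (a2 - a3) / ((fst x - a3 * snd x) * (a2 - a1))"
  by (simp add: to_cusps.abs_eq proportional_refl)

text \<open>The universal property of the quotient topology, restricted to an open set: continuity
  can be tested on homogeneous coordinates.\<close>

lemma continuous_on_from_cp1:
  fixes m :: "cp1 \<Rightarrow> 'a :: topological_space"
  assumes S: "open S" and cont: "continuous_on {x. x \<noteq> 0 \<and> abs_cp1 x \<in> S} (\<lambda>x. m (abs_cp1 x))"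
  shows "continuous_on S m"
  unfolding continuous_on_open_vimage[OF S]
proof (intro allI impI)
  fix B :: "'a set" assume B: "open B"
  let ?X = "{x. x \<noteq> 0 \<and> abs_cp1 x \<in> S}"
  have "open ?X" using S by (simp add: open_cp1_def)
  then have "open ((\<lambda>x. m (abs_cp1 x)) -` B \<inter> ?X)"
    using cont B continuous_on_open_vimage by blast
  moreover have "{x. x \<noteq> 0 \<and> abs_cp1 x \<in> m -` B \<inter> S} = (\<lambda>x. m (abs_cp1 x)) -` B \<inter> ?X" by auto
  ultimately show "open (m -` B \<inter> S)" by (simp add: open_cp1_def)
qed

lemma continuous_on_abs_cp1: "continuous_on (- {0}) abs_cp1"
proof -
  have "open (- {0 :: complex \<times> complex})" by (simp add: open_Compl)
  moreover have "abs_cp1 -` B \<inter> - {0} = {x. x \<noteq> 0 \<and> abs_cp1 x \<in> B}" for B by auto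
  ultimately show ?thesis by (simp add: continuous_on_open_vimage open_cp1_def)
qed

lemma homeomorphism_to_cusps:
  assumes ne: "a1 \<noteq> a2" "a1 \<noteq> a3" "a2 \<noteq> a3"
  shows "homeomorphism (- {affine_point a1, affine_point a2, affine_point a3}) (- {0, 1})
           (to_cusps a1 a2 a3) (from_cusps a1 a2 a3)"
proof
  let ?S = "- {affine_point a1, affine_point a2, affine_point a3}"
  define vec where
    "vec = (\<lambda>w. (a3 * w * (a2 - a1) - a1 * (a2 - a3), w * (a2 - a1) - (a2 - a3)))"
  have d: "a2 - a1 \<noteq> 0" "a2 - a3 \<noteq> 0" "a3 - a1 \<noteq> 0" "a1 - a3 \<noteq> 0" using ne by auto
  \<comment> \<open>The linear forms that vanish at the three punctures, evaluated on
    \<open>vec w\<close>: they are zero for w = 0, for no w, and for w = 1 respectively, which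
    settles both well-definedness and the range.\<close>
  have v1: "fst (vec w) - a1 * snd (vec w) = (a3 - a1) * (w * (a2 - a1))"
    and v3: "fst (vec w) - a3 * snd (vec w) = (a3 - a1) * (a2 - a3)"
    and v2: "fst (vec w) - a2 * snd (vec w) = (a2 - a1) * (a2 - a3) * (1 - w)" for w
    by (simp_all add: vec_def algebra_simps)
  have vec: "vec w \<noteq> 0" for w
  proof
    assume "vec w = 0"
    then have "fst (vec w) - a3 * snd (vec w) = 0" by simp
    then show False using d unfolding v3 by simp
  qed
  have S_iff: "abs_cp1 x \<in> ?S \<longleftrightarrow> fst x - a1 * snd x \<noteq> 0 \<and> fst x - a2 * snd x \<noteq> 0 \<and> fst x - a3 * snd x \<noteq> 0"
    if "x \<noteq> 0" for x
    using that by (simp add: abs_cp1_eq_affine_point_iff)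
  have from_cusps: "from_cusps a1 a2 a3 w = abs_cp1 (vec w)" for w
    by (simp add: from_cusps_def vec_def)
  have "?S = - {affine_point a1} \<inter> - {affine_point a2} \<inter> - {affine_point a3}" by auto
  then have "open ?S" by (metis open_Int open_Compl_affine_point)
  then show "continuous_on ?S (to_cusps a1 a2 a3)"
  proof (rule continuous_on_from_cp1)
    have "continuous_on {x. x \<noteq> 0 \<and> abs_cp1 x \<in> ?S}
       (\<lambda>x. (fst x - a1 * snd x) * (a2 - a3) / ((fst x - a3 * snd x) * (a2 - a1)))"
    proof (intro continuous_intros ballI)
      fix x assume "x \<in> {x. x \<noteq> 0 \<and> abs_cp1 x \<in> ?S}"
      then show "(fst x - a3 * snd x) * (a2 - a1) \<noteq> 0" using d S_iff[of x] by simp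
    qed
    then show "continuous_on {x. x \<noteq> 0 \<and> abs_cp1 x \<in> ?S} (\<lambda>x. to_cusps a1 a2 a3 (abs_cp1 x))"
      by (rule continuous_on_eq) (simp add: to_cusps_abs_cp1)
  qed
  show "continuous_on (- {0, 1}) (from_cusps a1 a2 a3)"
  proof -
    have "continuous_on (- {0, 1}) vec" unfolding vec_def by (intro continuous_intros)
    then have "continuous_on (- {0, 1}) (abs_cp1 \<circ> vec)"
      using vec by (intro continuous_on_compose continuous_on_subset[OF continuous_on_abs_cp1]) auto
    then show ?thesis by (simp add: from_cusps o_def)
  qed
  show "to_cusps a1 a2 a3 ` ?S \<subseteq> - {0, 1}"
  proof (intro image_subsetI)
    fix P assume P: "P \<in> ?S"
    obtain x where x: "x \<noteq> 0" "P = abs_cp1 x" by (rule abs_cp1_cases)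
    have nz: "fst x - a1 * snd x \<noteq> 0" "fst x - a2 * snd x \<noteq> 0" "fst x - a3 * snd x \<noteq> 0"
      using P S_iff[OF x(1)] x(2) by auto
    \<comment> \<open>Numerator minus denominator of \<open>to_cusps\<close> is a multiple of the
      linear form of \<open>a2\<close>, so the value 1 is not taken on the punctured line.\<close>
    have "(fst x - a1 * snd x) * (a2 - a3) - (fst x - a3 * snd x) * (a2 - a1)
        = (a1 - a3) * (fst x - a2 * snd x)" by (simp add: algebra_simps)
    then have "(fst x - a1 * snd x) * (a2 - a3) \<noteq> (fst x - a3 * snd x) * (a2 - a1)"
      using d nz by (metis eq_iff_diff_eq_0 mult_eq_0_iff)
    then show "to_cusps a1 a2 a3 P \<in> - {0, 1}"
      using x d nz by (simp add: to_cusps_abs_cp1 divide_eq_1_iff)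
  qed
  show "from_cusps a1 a2 a3 ` (- {0, 1}) \<subseteq> ?S"
  proof (intro image_subsetI)
    fix w :: complex assume "w \<in> - {0, 1}"
    then show "from_cusps a1 a2 a3 w \<in> ?S"
      unfolding from_cusps S_iff[OF vec] v1 v2 v3 using d by simp
  qed
  show "to_cusps a1 a2 a3 (from_cusps a1 a2 a3 w) = w" if "w \<in> - {0, 1}" for w
    unfolding from_cusps to_cusps_abs_cp1[OF vec] v1 v3 using d by simp
  show "from_cusps a1 a2 a3 (to_cusps a1 a2 a3 P) = P" if P: "P \<in> ?S" for P
  proof -
    obtain x where x: "x \<noteq> 0" "P = abs_cp1 x" by (rule abs_cp1_cases)
    define r s where "r = fst x - a1 * snd x" and "s = fst x - a3 * snd x"
    have s: "s \<noteq> 0" using P S_iff[OF x(1)] x(2) by (auto simp: s_def)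
    define w where "w = to_cusps a1 a2 a3 P"
    have "w = r * (a2 - a3) / (s * (a2 - a1))" using x by (simp add: w_def to_cusps_abs_cp1 r_def s_def)
    then have "w * (a2 - a1) = r * (a2 - a3) / s" using d by simp
    then have "vec w = (a3 * (r * (a2 - a3) / s) - a1 * (a2 - a3), r * (a2 - a3) / s - (a2 - a3))"
      by (simp add: vec_def mult.assoc)
    then have "s * fst (vec w) = (a2 - a3) * (a3 * r - a1 * s)" "s * snd (vec w) = (a2 - a3) * (r - s)"
      using s by (simp_all add: field_simps)
    moreover have "a3 * r - a1 * s = (a3 - a1) * fst x" "r - s = (a3 - a1) * snd x"
      by (simp_all add: r_def s_def algebra_simps)
    ultimately have "s * (fst (vec w) * snd x) = s * (fst x * snd (vec w))"
      by (metis (no_types, opaque_lifting) mult.assoc mult.commute mult.left_commute)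
    then have "fst (vec w) * snd x = fst x * snd (vec w)" using s by simp
    then have "abs_cp1 (vec w) = abs_cp1 x"
      using x(1) vec[of w] by (simp add: abs_cp1_eq_iff proportional_iff_det)
    then show ?thesis using x by (simp add: from_cusps w_def)
  qed
qed

lemma affine_coord_affine_point [simp]: "affine_coord (affine_point z) = z"
  by transfer simp

lemma to_cusps_affine_coord:
  assumes "P \<noteq> cp1_infinity"
  shows "to_cusps a1 a2 a3 P =
    (affine_coord P - a1) * (a2 - a3) / ((affine_coord P - a3) * (a2 - a1))"
proof -
  obtain x where x: "x \<noteq> 0" "P = abs_cp1 x" by (rule abs_cp1_cases)
  then have nz: "snd x \<noteq> 0" using assms abs_cp1_eq_infinity_iff by blast
  then have "fst x / snd x - a = (fst x - a * snd x) / snd x" for a by (simp add: field_simps)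
  then show ?thesis
    using x nz by (simp add: to_cusps_abs_cp1 affine_coord.abs_eq proportional_refl)
qed

lemma to_cusps_infinity_coord:
  assumes "P \<noteq> affine_point 0"
  shows "to_cusps a1 a2 a3 P =
    (1 - a1 * infinity_coord P) * (a2 - a3) / ((1 - a3 * infinity_coord P) * (a2 - a1))"
proof -
  obtain x where x: "x \<noteq> 0" "P = abs_cp1 x" by (rule abs_cp1_cases)
  then have nz: "fst x \<noteq> 0" using assms abs_cp1_eq_affine_point_iff[of x 0] by auto
  then have "1 - a * (snd x / fst x) = (fst x - a * snd x) / fst x" for a by (simp add: field_simps)
  then show ?thesis
    using x nz by (simp add: to_cusps_abs_cp1 infinity_coord.abs_eq proportional_refl)
qed

lemma affine_coord_eq_iff: "P \<noteq> cp1_infinity \<Longrightarrow> affine_coord P = a \<longleftrightarrow> P = affine_point a"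
proof -
  assume P: "P \<noteq> cp1_infinity"
  obtain x where x: "x \<noteq> 0" "P = abs_cp1 x" by (rule abs_cp1_cases)
  then have "snd x \<noteq> 0" using P abs_cp1_eq_infinity_iff by blast
  then show ?thesis
    using x by (simp add: affine_coord.abs_eq proportional_refl abs_cp1_eq_affine_point_iff field_simps)
qed

lemma infinity_coord_nz:
  assumes "P \<noteq> affine_point 0" "P \<noteq> affine_point a"
  shows "1 - a * infinity_coord P \<noteq> 0"
proof -
  obtain x where x: "x \<noteq> 0" "P = abs_cp1 x" by (rule abs_cp1_cases)
  then have "fst x \<noteq> 0" "fst x \<noteq> a * snd x"
    using assms abs_cp1_eq_affine_point_iff[of x 0] abs_cp1_eq_affine_point_iff[of x a] by auto
  then show ?thesis using x by (simp add: infinity_coord.abs_eq proportional_refl field_simps)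
qed

section \<open>The induced metric expressed through the height\<close>

context
  fixes a1 a2 a3 :: complex and p :: "complex \<Rightarrow> cp1"
  assumes ne: "a1 \<noteq> a2" "a1 \<noteq> a3" "a2 \<noteq> a3"
    and huc: "holomorphic_universal_covering p (- {affine_point a1, affine_point a2, affine_point a3})"
begin

lemma covering_to_cusps: "covering_space upper_half_plane (to_cusps a1 a2 a3 \<circ> p) (- {0, 1})"
  using huc homeomorphism_to_cusps[OF ne]
  by (auto simp: holomorphic_universal_covering_def intro: covering_space_homeomorphism_compose)

lemma open_covering_vimage:
  assumes "open U"
  shows "open {\<tau> \<in> upper_half_plane. p \<tau> \<in> U}"
proof -
  have "continuous_on upper_half_plane p"
    using huc by (auto simp: holomorphic_universal_covering_def dest: covering_space_imp_continuous)
  moreover have "open upper_half_plane" unfolding upper_half_plane_def by (rule open_halfspace_Im_gt)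
  ultimately have "open (p -` U \<inter> upper_half_plane)" using assms continuous_on_open_vimage by blast
  moreover have "p -` U \<inter> upper_half_plane = {\<tau> \<in> upper_half_plane. p \<tau> \<in> U}" by auto
  ultimately show ?thesis by simp
qed

lemma covering_avoids: "\<tau> \<in> upper_half_plane \<Longrightarrow> p \<tau> \<notin> {affine_point a1, affine_point a2, affine_point a3}"
  using huc covering_space_imp_surjective unfolding holomorphic_universal_covering_def by blast

text \<open>Infinity is not a puncture, so \<open>p\<close> passes through it and the affine chart
  alone does not suffice. The Moebius map is a rational function without poles in each of the two
  charts along \<open>p\<close>.\<close>

lemma holomorphic_to_cusps: "(to_cusps a1 a2 a3 \<circ> p) holomorphic_on upper_half_plane"
proof -
  let ?A = "{\<tau> \<in> upper_half_plane. p \<tau> \<noteq> cp1_infinity}"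
  let ?B = "{\<tau> \<in> upper_half_plane. p \<tau> \<noteq> affine_point 0}"
  have hol: "(\<lambda>\<tau>. affine_coord (p \<tau>)) holomorphic_on ?A" "(\<lambda>\<tau>. infinity_coord (p \<tau>)) holomorphic_on ?B"
    using huc by (auto simp: holomorphic_universal_covering_def holomorphic_to_cp1_def)
  have op: "open ?A" "open ?B"
    using open_covering_vimage[OF open_Compl_infinity] open_covering_vimage[OF open_Compl_affine_point]
    by simp_all
  have d: "a2 - a1 \<noteq> 0" using ne by simp
  have "(\<lambda>\<tau>. (affine_coord (p \<tau>) - a1) * (a2 - a3) / ((affine_coord (p \<tau>) - a3) * (a2 - a1)))
      holomorphic_on ?A"
  proof (intro holomorphic_intros hol)
    fix \<tau> assume "\<tau> \<in> ?A"
    then show "(affine_coord (p \<tau>) - a3) * (a2 - a1) \<noteq> 0"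
      using covering_avoids[of \<tau>] d by (simp add: affine_coord_eq_iff)
  qed
  then have A: "(to_cusps a1 a2 a3 \<circ> p) holomorphic_on ?A"
    by (rule holomorphic_transform) (simp add: to_cusps_affine_coord)
  have "(\<lambda>\<tau>. (1 - a1 * infinity_coord (p \<tau>)) * (a2 - a3) / ((1 - a3 * infinity_coord (p \<tau>)) * (a2 - a1)))
      holomorphic_on ?B"
  proof (intro holomorphic_intros hol)
    fix \<tau> assume "\<tau> \<in> ?B"
    then show "(1 - a3 * infinity_coord (p \<tau>)) * (a2 - a1) \<noteq> 0"
      using covering_avoids[of \<tau>] d infinity_coord_nz[of "p \<tau>" a3] by simp
  qed
  then have B: "(to_cusps a1 a2 a3 \<circ> p) holomorphic_on ?B"
    by (rule holomorphic_transform) (simp add: to_cusps_infinity_coord)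
  have "cp1_infinity \<noteq> affine_point 0"
    by (metis abs_cp1_eq_affine_point_iff cp1_infinity.abs_eq fst_conv mult_zero_left one_neq_zero zero_prod_def)
  then have "?A \<union> ?B = upper_half_plane" by auto
  with holomorphic_on_Un[OF A B op] show ?thesis by simp
qed

text \<open>By \<open>kobayashi_radius_covering\<close> the product of Im \<tau> and the norm of the
  derivative of \<open>p\<close> in the affine coordinate is the same at all \<tau> over
  \<open>z\<close>. This makes the definite description meaningful and gives its value.\<close>

lemma KE_length_eq:
  assumes z: "z \<noteq> a1" "z \<noteq> a2" "z \<noteq> a3"
    and w: "w = (z - a1) * (a2 - a3) / ((z - a3) * (a2 - a1))" "0 < cusp_height w"
  shows "KE_length p z v = norm ((a1 - a3) / ((z - a1) * (z - a3))) / cusp_height w * norm v"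
proof -
  define \<phi> where "\<phi> = to_cusps a1 a2 a3 \<circ> p"
  define M' where "M' = (a1 - a3) * (a2 - a3) / ((z - a3)\<^sup>2 * (a2 - a1))"
  have d: "a2 - a1 \<noteq> 0" "a2 - a3 \<noteq> 0" "a1 - a3 \<noteq> 0" "z - a1 \<noteq> 0" "z - a3 \<noteq> 0" using ne z by auto
  have M': "M' \<noteq> 0" using d by (simp add: M'_def)
  have w0: "w \<noteq> 0" using d by (simp add: w(1))
  let ?A = "{\<tau> \<in> upper_half_plane. p \<tau> \<noteq> cp1_infinity}"
  have opA: "open ?A" using open_covering_vimage[OF open_Compl_infinity] by simp
  have holA: "(\<lambda>\<tau>. affine_coord (p \<tau>)) holomorphic_on ?A"
    using huc by (auto simp: holomorphic_universal_covering_def holomorphic_to_cp1_def)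
  have inf: "affine_point z \<noteq> cp1_infinity"
  proof -
    have "(1, 0) \<noteq> (0 :: complex \<times> complex)" by (simp add: zero_prod_def)
    then show ?thesis
      using abs_cp1_eq_affine_point_iff[of "(1, 0)" z] by (auto simp: cp1_infinity.abs_eq)
  qed
  have *: "deriv (\<lambda>t. affine_coord (p t)) \<tau> \<noteq> 0 \<and>
      norm (deriv (\<lambda>t. affine_coord (p t)) \<tau>) * Im \<tau> * norm M' = norm w * cusp_height w"
    if \<tau>: "\<tau> \<in> upper_half_plane" "p \<tau> = affine_point z" for \<tau>
  proof -
    let ?D = "deriv (\<lambda>t. affine_coord (p t)) \<tau>"
    have \<tau>A: "\<tau> \<in> ?A" using \<tau> inf by simp
    have dA: "((\<lambda>t. affine_coord (p t)) has_field_derivative ?D) (at \<tau>)"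
      using holA opA \<tau>A by (rule holomorphic_derivI)
    have dM: "((\<lambda>f. (f - a1) * (a2 - a3) / ((f - a3) * (a2 - a1))) has_field_derivative M')
        (at (affine_coord (p \<tau>)))"
    proof -
      have "((\<lambda>f. (f - a1) / (f - a3)) has_field_derivative (a1 - a3) / (z - a3)\<^sup>2) (at z)"
        using d by (auto intro!: derivative_eq_intros simp: power2_eq_square)
      from DERIV_cmult[OF this, of "(a2 - a3) / (a2 - a1)"]
      show ?thesis using \<tau>(2) by (simp add: M'_def mult_ac)
    qed
    have "deriv \<phi> \<tau> = ?D * M'"
    proof (rule DERIV_imp_deriv, rule has_field_derivative_transform_within_open[OF _ opA \<tau>A])
      show "((\<lambda>t. (affine_coord (p t) - a1) * (a2 - a3) / ((affine_coord (p t) - a3) * (a2 - a1)))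
          has_field_derivative ?D * M') (at \<tau>)"
        using DERIV_chain'[OF dA dM] by (simp add: mult.commute)
    qed (simp add: \<phi>_def to_cusps_affine_coord)
    moreover have "\<phi> \<tau> = w" using \<tau>(2) inf by (simp add: \<phi>_def to_cusps_affine_coord w(1))
    ultimately have "kobayashi_radius w = 2 * norm (?D * M') * Im \<tau>"
      using kobayashi_radius_covering[OF covering_to_cusps holomorphic_to_cusps \<tau>(1)]
      by (simp add: \<phi>_def)
    then have "norm ?D * Im \<tau> * norm M' = norm w * cusp_height w"
      using w0 by (simp add: cusp_height_def norm_mult)
    moreover from this have "?D \<noteq> 0" using w0 w(2) by (auto simp: zero_less_mult_iff)
    ultimately show ?thesis by simp
  qed
  have "affine_point z \<in> - {affine_point a1, affine_point a2, affine_point a3}"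
    using z by (metis Compl_iff affine_coord_affine_point empty_iff insert_iff)
  then have "affine_point z \<in> p ` upper_half_plane"
    using huc covering_space_imp_surjective unfolding holomorphic_universal_covering_def by blast
  then obtain \<tau> where \<tau>: "\<tau> \<in> upper_half_plane" "p \<tau> = affine_point z" by (metis imageE)
  have len: "norm u / Im \<sigma> = norm v * norm M' / (norm w * cusp_height w)"
    if \<sigma>: "\<sigma> \<in> upper_half_plane" "p \<sigma> = affine_point z"
      and u: "deriv (\<lambda>t. affine_coord (p t)) \<sigma> * u = v" for \<sigma> u
  proof -
    have "Im \<sigma> > 0" using \<sigma> by (simp add: upper_half_plane_def)
    then show ?thesis
      using conjunct1[OF *[OF \<sigma>]] M'
      unfolding u[symmetric] norm_mult conjunct2[OF *[OF \<sigma>], symmetric] by simp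
  qed
  have "KE_length p z v = norm v * norm M' / (norm w * cusp_height w)"
    unfolding KE_length_def
  proof (rule the_equality)
    let ?u = "v / deriv (\<lambda>t. affine_coord (p t)) \<tau>"
    have "deriv (\<lambda>t. affine_coord (p t)) \<tau> * ?u = v" using *[OF \<tau>] by simp
    with len[OF \<tau> this] \<tau> show "\<exists>\<tau> u. \<tau> \<in> upper_half_plane \<and> p \<tau> = affine_point z \<and>
        deriv (\<lambda>t. affine_coord (p t)) \<tau> * u = v \<and>
        norm v * norm M' / (norm w * cusp_height w) = poincare_length \<tau> u"
      unfolding poincare_length_def by metis
  qed (use len in \<open>auto simp: poincare_length_def\<close>)
  \<comment> \<open>The logarithmic derivative of the Moebius map, in which \<open>a2\<close> no
    longer occurs.\<close>
  moreover have "M' / w = (a1 - a3) / ((z - a1) * (z - a3))"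
    using d by (simp add: M'_def w(1) power2_eq_square)
  then have "norm M' / norm w = norm ((a1 - a3) / ((z - a1) * (z - a3)))" by (metis norm_divide)
  moreover have "norm v * norm M' / (norm w * cusp_height w) = norm M' / norm w / cusp_height w * norm v"
    by simp
  ultimately show ?thesis by simp
qed

end

subsection \<open>The expansion of the density\<close>

lemma bigo_exp:
  fixes y :: "'a \<Rightarrow> real"
  assumes "(y \<longlongrightarrow> 0) F"
  shows "(\<lambda>z. exp (y z) - 1 - y z) \<in> O[F](\<lambda>z. (y z)\<^sup>2)"
proof (rule bigoI[of _ 1])
  have "eventually (\<lambda>z. dist (y z) 0 < 1) F" by (rule tendstoD[OF assms]) auto
  then show "eventually (\<lambda>z. norm (exp (y z) - 1 - y z) \<le> 1 * norm ((y z)\<^sup>2)) F"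
  proof eventually_elim
    case (elim z)
    have "exp t \<le> 1 + t + t\<^sup>2" if "\<bar>t\<bar> < 1" for t :: real
    proof (cases "0 \<le> t")
      case True
      then show ?thesis using that exp_bound by simp
    next
      case False
      have "0 < 1 + t + t\<^sup>2" using that by (auto simp: add_pos_nonneg)
      then have "1 + (- t) \<le> exp (- t)" by (intro exp_ge_add_one_self)
      \<comment> \<open>For negative t the bound on exp t comes from the one on exp (- t), since (1
        + t + t^2) (1 - t) = 1 - t^3 is at least 1.\<close>
      then have "(1 + t + t\<^sup>2) * (1 - t) \<le> (1 + t + t\<^sup>2) * exp (- t)"
        using \<open>0 < 1 + t + t\<^sup>2\<close> by (intro mult_left_mono) auto
      moreover have "(1 + t + t\<^sup>2) * (1 - t) = 1 - t ^ 3"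
        by (simp add: power2_eq_square power3_eq_cube algebra_simps)
      moreover have "t ^ 3 \<le> 0" using False by (simp add: power_le_zero_eq)
      ultimately have "1 \<le> (1 + t + t\<^sup>2) * exp (- t)" by linarith
      then have "1 * exp t \<le> (1 + t + t\<^sup>2) * exp (- t) * exp t" by (intro mult_right_mono) auto
      moreover have "exp (- t) * exp t = 1" by (simp add: exp_add[symmetric])
      ultimately show ?thesis by (simp only: mult.assoc mult_1_left mult_1_right)
    qed
    from this[of "y z"] have "\<bar>exp (y z) - 1 - y z\<bar> \<le> (y z)\<^sup>2"
      using elim exp_ge_add_one_self[of "y z"] zero_le_power2[of "y z"]
      unfolding dist_real_def by linarith
    then show ?case by simp
  qed
qed

text \<open>The squares of |1 - x| and 1 - Re x differ by (Im x)^2, and their sum is at least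
  1.\<close>

lemma norm_one_minus_approx:
  fixes x :: complex
  assumes "norm x \<le> 1 / 2"
  shows "\<bar>norm (1 - x) - (1 - Re x)\<bar> \<le> (norm x)\<^sup>2"
proof -
  define a n where "a = 1 - Re x" and "n = norm (1 - x)"
  have a: "1 / 2 \<le> a" using assms complex_Re_le_cmod[of x] by (simp add: a_def)
  have n: "a \<le> n" using complex_Re_le_cmod[of "1 - x"] by (simp add: a_def n_def)
  have "(n - a) * 1 \<le> (n - a) * (n + a)" using a n by (intro mult_left_mono) auto
  also have "\<dots> = n\<^sup>2 - a\<^sup>2" by (simp add: power2_eq_square algebra_simps)
  also have "\<dots> = (Im x)\<^sup>2" by (simp add: n_def a_def cmod_power2)
  also have "\<dots> \<le> (norm x)\<^sup>2" by (simp add: cmod_power2)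
  finally show ?thesis using n by (simp add: n_def a_def)
qed

text \<open>Here F is the normalised cusp coordinate and \<open>w F\<close> the coordinate with
  cusps 0, 1 and infinity. The slope 16 of \<open>w\<close> at 0 cancels the constant ln 16 of
  \<open>cusp_model\<close>, so that |log |F|| appears without an additive constant.\<close>

lemma cusp_density_expansion:
  fixes t :: complex
  defines "w \<equiv> \<lambda>F. 16 * F / (1 + 16 * t * F)" and "c \<equiv> 2 * t - 1"
  shows "eventually (\<lambda>F. 0 < cusp_height (w F)) (at 0)"
    and "(\<lambda>F. \<bar>ln (norm F)\<bar> / (norm (1 + 16 * t * F) * cusp_height (w F))
        - norm (1 - 8 * (c * F - of_real (Re (c * F) / ln (norm F))))) \<in> O[at 0](\<lambda>F. (norm F)\<^sup>2)"
proof -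
  let ?Q = "\<lambda>z :: complex. (norm z)\<^sup>2 :: real"
  let ?N = "\<lambda>z :: complex. norm z"
  \<comment> \<open>Small enough for 1 + 16 t F and 1 - \<open>w F\<close> to have positive real
    part, where \<open>Ln\<close> is holomorphic.\<close>
  define r where "r = 1 / (32 * (norm t + 1))"
  have r: "0 < r" by (simp add: r_def add_nonneg_pos)
  have ball: "norm (16 * t * F) < 1 / 2 \<and> norm (w F) < 1" if "norm F < r" for F
  proof -
    have F: "32 * (norm t + 1) * norm F < 1"
    proof -
      have "0 < 32 * (norm t + 1)" by (simp add: add_nonneg_pos)
      from pos_less_divide_eq[OF this, of "norm F" 1] show ?thesis
        using that by (simp add: r_def mult.commute)
    qed
    have "0 \<le> norm t * norm F" "0 \<le> norm F" by simp_all
    moreover have "32 * (norm t * norm F) + 32 * norm F < 1" using F by (simp add: algebra_simps)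
    ultimately have 1: "32 * (norm t * norm F) < 1" "32 * norm F < 1" by linarith+
    then have 2: "norm (16 * t * F) < 1 / 2" by (simp add: norm_mult)
    have "norm (1 + 16 * t * F) \<ge> 1 - norm (16 * t * F)"
      using norm_triangle_ineq2[of 1 "- (16 * t * F)"] by simp
    then have "norm (1 + 16 * t * F) > 1 / 2" using 2 by linarith
    then have "norm (w F) < 1"
      using 1 by (simp add: w_def norm_divide norm_mult divide_less_eq)
    with 2 show ?thesis by blast
  qed
  have re1: "Re (1 + 16 * t * F) > 0" if "norm F < r" for F
    using ball[OF that] complex_Re_le_cmod[of "- (16 * t * F)"] by simp
  have re2: "Re (1 - w F) > 0" if "norm F < r" for F
    using ball[OF that] complex_Re_le_cmod[of "w F"] by simp
  have nz: "1 + 16 * t * F \<noteq> 0" if "norm F < r" for F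
    using re1[OF that] by (metis less_irrefl zero_complex.sel(1))
  have notnp: "1 + 16 * t * F \<notin> \<real>\<^sub>\<le>\<^sub>0" "1 - w F \<notin> \<real>\<^sub>\<le>\<^sub>0" if "norm F < r" for F
    using re1[OF that] re2[OF that] by (auto simp: complex_nonpos_Reals_iff)
  have holw: "w holomorphic_on ball 0 r"
    unfolding w_def using nz by (intro holomorphic_intros) auto
  have dw: "(w has_field_derivative 16) (at 0)"
    unfolding w_def by (auto intro!: derivative_eq_intros)
  have w0: "w 0 = 0" by (simp add: w_def)
  \<comment> \<open>The real part of \<open>f1\<close> is the correction to - ln |F| in the bracket
    of the model; that of \<open>f2\<close> is the logarithm of the remaining factors 1 / |1 + 16 t
    F| and 1 / sqrt |1 - w|. Their slopes 16 t - 8 = 8 c and -8 c produce the two first-order terms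
    of the expansion.\<close>
  define f1 where "f1 = (\<lambda>F. Ln (1 + 16 * t * F) - w F / 2)"
  define f2 where "f2 = (\<lambda>F. - Ln (1 + 16 * t * F) - Ln (1 - w F) / 2)"
  have hol1: "f1 holomorphic_on ball 0 r" and hol2: "f2 holomorphic_on ball 0 r"
    unfolding f1_def f2_def using notnp by (auto intro!: holomorphic_intros holw)
  have "(f1 has_field_derivative 8 * c) (at 0)"
    unfolding f1_def c_def by (auto intro!: derivative_eq_intros dw)
  from Re_holomorphic_quadratic_remainder[OF hol1 r this]
  have R1: "(\<lambda>F. Re (f1 F) - Re (8 * c * F)) \<in> O[at 0](?Q)" by (simp add: f1_def w0)
  have "(f2 has_field_derivative - 8 * c) (at 0)"
    unfolding f2_def c_def by (auto intro!: derivative_eq_intros dw simp: w0)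
  from Re_holomorphic_quadratic_remainder[OF hol2 r this]
  have R2: "(\<lambda>F. Re (f2 F) - Re (- 8 * c * F)) \<in> O[at 0](?Q)" by (simp add: f2_def w0)

  have limN: "(?N \<longlongrightarrow> 0) (at 0)" and limQ: "(?Q \<longlongrightarrow> 0) (at 0)"
    by (auto intro!: tendsto_eq_intros)
  have QN: "?Q \<in> O[at 0](?N)"
  proof (rule bigoI[of _ 1])
    have "eventually (\<lambda>z :: complex. z \<in> ball 0 1 - {0}) (at 0)"
      by (intro eventually_at_in_open) auto
    then show "eventually (\<lambda>z :: complex. norm (?Q z) \<le> 1 * norm (?N z)) (at 0)"
      by eventually_elim (auto simp: power2_eq_square intro: mult_left_le)
  qed
  have sq: "(\<lambda>z. (f z)\<^sup>2) \<in> O[at 0](?Q)" if "f \<in> O[at 0](?N)" for f :: "complex \<Rightarrow> real"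
    using landau_o.big_power[OF that, of 2] by simp
  have lin: "(\<lambda>F. Re (b * F)) \<in> O[at 0](?N)" for b
    using abs_Re_le_cmod[of "b * _"]
    by (intro bigoI[of _ "norm b"] always_eventually allI) (simp add: norm_mult)
  define l where "l = (\<lambda>F :: complex. - ln (norm F))"
  have pos_l: "eventually (\<lambda>F. 0 < l F) (at 0)"
    using filterlim_minus_ln_norm unfolding filterlim_at_top_dense l_def by blast
  have "((\<lambda>F. 1 / l F) \<longlongrightarrow> 0) (at 0)"
    using tendsto_inverse_0_at_top[OF filterlim_minus_ln_norm] by (simp add: inverse_eq_divide l_def)
  then have il: "(\<lambda>F. 1 / l F) \<in> O[at 0](\<lambda>_. 1)" by (intro bigoI_tendsto[where c = 0]) auto
  have div_l: "(\<lambda>F. f F / l F) \<in> O[at 0](g)" if "f \<in> O[at 0](g)" for f and g :: "complex \<Rightarrow> real"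
    using landau_o.big.mult[OF that il] by simp

  define x where "x = (\<lambda>F. Re (f1 F) / l F)"
  have "(\<lambda>F. (Re (f1 F) - Re (8 * c * F)) + Re (8 * c * F)) \<in> O[at 0](?N)"
    by (intro sum_in_bigo lin landau_o.big_trans[OF R1 QN])
  then have xN: "x \<in> O[at 0](?N)" unfolding x_def by (intro div_l) simp
  have xlim: "(x \<longlongrightarrow> 0) (at 0)" by (rule bigo_imp_tendsto_0[OF xN limN])
  have lnx: "(\<lambda>F. ln (1 + x F) - x F) \<in> O[at 0](?Q)"
    by (rule landau_o.big_trans[OF bigo_ln_one_plus[OF xlim] sq[OF xN]])
  have x1: "(\<lambda>F. x F - Re (8 * c * F) / l F) \<in> O[at 0](?Q)"
    using div_l[OF R1] by (simp add: x_def diff_divide_distrib)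
  from sum_in_bigo(1)[OF lnx x1]
  have X: "(\<lambda>F. ln (1 + x F) - Re (8 * c * F) / l F) \<in> O[at 0](?Q)" by simp

  have wlim: "filterlim w (at 0) (at 0)"
  proof -
    have "isCont w 0" using dw by (rule DERIV_isCont)
    then have "(w \<longlongrightarrow> 0) (at 0)" by (simp add: isCont_def w0)
    moreover have "eventually (\<lambda>F. F \<in> ball 0 r - {0}) (at 0)"
      using r by (intro eventually_at_in_open) auto
    then have "eventually (\<lambda>F. w F \<noteq> 0) (at 0)"
      by eventually_elim (use nz in \<open>auto simp: w_def\<close>)
    ultimately show ?thesis by (auto simp: filterlim_at elim: eventually_mono)
  qed
  define v where "v = (\<lambda>F. ln (cusp_height (w F)) - ln (cusp_model (w F)))"
  have "((\<lambda>F. w F / F) \<longlongrightarrow> 16) (at 0)"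
    using dw by (simp add: has_field_derivative_iff w0)
  then have "w \<in> O[at 0](\<lambda>F. F)"
    by (rule bigoI_tendsto) (simp add: eventually_at_filter)
  then have wN: "(\<lambda>F. norm (w F)) \<in> O[at 0](?N)" by simp
  have V: "v \<in> O[at 0](?Q)"
    unfolding v_def
    by (rule landau_o.big_trans[OF landau_o.big.compose[OF cusp_height_expansion wlim] sq[OF wN]])

  have pos_h: "eventually (\<lambda>z. 0 < cusp_height z / - ln (norm z)) (at 0)"
    by (rule order_tendstoD(1)[OF cusp_height_asymp]) simp
  have pos_m: "eventually (\<lambda>z. 0 < cusp_model z / - ln (norm z)) (at 0)"
    by (rule order_tendstoD(1)[OF cusp_model_asymp]) simp
  have pos: "eventually (\<lambda>z. 0 < cusp_height z \<and> 0 < cusp_model z) (at 0)"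
    using pos_h pos_m filterlim_minus_ln_norm[unfolded filterlim_at_top_dense, rule_format, of 0]
    by eventually_elim (auto simp: divide_less_0_iff)
  from filterlim_iff[THEN iffD1, OF wlim, rule_format, OF pos]
  have posw: "eventually (\<lambda>F. 0 < cusp_height (w F) \<and> 0 < cusp_model (w F)) (at 0)" .
  then show "eventually (\<lambda>F. 0 < cusp_height (w F)) (at 0)" by (auto elim: eventually_mono)

  define G where "G = (\<lambda>F. \<bar>ln (norm F)\<bar> / (norm (1 + 16 * t * F) * cusp_height (w F)))"
  \<comment> \<open>Near 0 this is the logarithm of \<open>G\<close>: \<open>v\<close> replaces the
    height by the model, and 1 + \<open>x\<close> is the model's bracket divided by - ln
    |F|.\<close>
  define y where "y = (\<lambda>F. Re (f2 F) - v F - ln (1 + x F))"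
  define Y where "Y = (\<lambda>F. 8 * (c * F - of_real (Re (c * F) / ln (norm F))))"
  have ReY: "Re (Y F) = Re (8 * c * F) + Re (8 * c * F) / l F" for F
    by (simp add: Y_def l_def algebra_simps)
  have "(\<lambda>F. (Re (f2 F) - Re (- 8 * c * F)) - v F - (ln (1 + x F) - Re (8 * c * F) / l F)) \<in> O[at 0](?Q)"
    by (intro sum_in_bigo R2 V X)
  then have yY: "(\<lambda>F. y F + Re (Y F)) \<in> O[at 0](?Q)" by (simp add: y_def ReY algebra_simps)
  have "(\<lambda>F. Re (8 * c * F) + Re (8 * c * F) / l F) \<in> O[at 0](?N)"
    by (intro sum_in_bigo lin div_l)
  then have ReYN: "(\<lambda>F. Re (Y F)) \<in> O[at 0](?N)" by (simp add: ReY)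
  have "(\<lambda>F. (y F + Re (Y F)) - Re (Y F)) \<in> O[at 0](?N)"
    by (intro sum_in_bigo ReYN landau_o.big_trans[OF yY QN])
  then have yN: "y \<in> O[at 0](?N)" by simp
  have ylim: "(y \<longlongrightarrow> 0) (at 0)" by (rule bigo_imp_tendsto_0[OF yN limN])
  have E1: "(\<lambda>F. exp (y F) - 1 - y F) \<in> O[at 0](?Q)"
    by (rule landau_o.big_trans[OF bigo_exp[OF ylim] sq[OF yN]])
  have YN: "(\<lambda>F. norm (Y F)) \<in> O[at 0](?N)"
  proof -
    have "(\<lambda>F. of_real (Re (c * F) / l F) :: complex) \<in> O[at 0](\<lambda>F. F)"
    proof -
      obtain C where "eventually (\<lambda>F. norm (Re (c * F) / l F) \<le> C * norm (norm F)) (at 0)"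
        using div_l[OF lin[of c]] by (rule landau_o.bigE)
      then show ?thesis
        by (intro bigoI[of _ C]) (simp only: norm_of_real real_norm_def abs_norm_cancel)
    qed
    moreover have "(\<lambda>F. c * F) \<in> O[at 0](\<lambda>F. F)"
      by (intro bigoI[of _ "norm c"]) (simp add: norm_mult)
    ultimately have "(\<lambda>F. c * F + of_real (Re (c * F) / l F)) \<in> O[at 0](\<lambda>F. F)"
      by (rule sum_in_bigo(1)[rotated])
    then have "(\<lambda>F. 8 * (c * F + of_real (Re (c * F) / l F))) \<in> O[at 0](\<lambda>F. F)"
      by (subst landau_o.big.cmult_in_iff) simp_all
    then show ?thesis by (simp add: Y_def l_def)
  qed
  have "(\<lambda>F. norm (1 - Y F) - (1 - Re (Y F))) \<in> O[at 0](\<lambda>F. (norm (Y F))\<^sup>2)"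
  proof (rule bigoI[of _ 1])
    have "eventually (\<lambda>F. dist (norm (Y F)) 0 < 1 / 2) (at 0)"
      by (rule tendstoD[OF bigo_imp_tendsto_0[OF YN limN]]) simp
    then show "eventually (\<lambda>F. norm (norm (1 - Y F) - (1 - Re (Y F))) \<le> 1 * norm ((norm (Y F))\<^sup>2)) (at 0)"
      by eventually_elim (use norm_one_minus_approx in auto)
  qed
  then have E2: "(\<lambda>F. norm (1 - Y F) - (1 - Re (Y F))) \<in> O[at 0](?Q)"
    using sq[OF YN] landau_o.big_trans by blast
  \<comment> \<open>Both exp y and |1 - Y| equal 1 - Re Y up to a quadratic error; only the real
    part of the complex first-order term is visible in the modulus.\<close>
  have "(\<lambda>F. (exp (y F) - 1 - y F) + (y F + Re (Y F)) - (norm (1 - Y F) - (1 - Re (Y F)))) \<in> O[at 0](?Q)"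
    by (intro sum_in_bigo E1 E2 yY)
  then have "(\<lambda>F. exp (y F) - norm (1 - Y F)) \<in> O[at 0](?Q)" by simp
  moreover have "eventually (\<lambda>F. exp (y F) - norm (1 - Y F) = G F - norm (1 - Y F)) (at 0)"
  proof -
    have ball_ev: "eventually (\<lambda>F. F \<in> ball 0 r - {0}) (at 0)"
      using r by (intro eventually_at_in_open) auto
    have "((\<lambda>F. 1 + x F) \<longlongrightarrow> 1 + 0) (at 0)" by (intro tendsto_intros xlim)
    then have x_ev: "eventually (\<lambda>F. 0 < 1 + x F) (at 0)" by (rule order_tendstoD) simp
    show ?thesis
      using ball_ev x_ev pos_l posw
    proof eventually_elim
      case (elim F)
      then have F: "F \<noteq> 0" "norm F < r" by auto
      define q where "q = 1 + 16 * t * F"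
      have q: "q \<noteq> 0" using nz[OF F(2)] by (simp add: q_def)
      have wq: "w F = 16 * F / q" by (simp add: w_def q_def)
      have w1: "1 - w F \<noteq> 0" using re2[OF F(2)] by auto
      have lnw: "ln (norm (w F)) = ln 16 + ln (norm F) - ln (norm q)"
        using F q by (simp add: wq norm_divide norm_mult ln_mult ln_div)
      have "ln 16 - ln (norm (w F)) - Re (w F) / 2 = l F + Re (f1 F)"
        using q by (simp add: lnw l_def f1_def q_def[symmetric])
      also have "\<dots> = l F * (1 + x F)" using elim by (simp add: x_def field_simps)
      finally have "cusp_model (w F) = sqrt (norm (1 - w F)) * (l F * (1 + x F))"
        by (simp add: cusp_model_def)
      then have "ln (cusp_model (w F)) = ln (norm (1 - w F)) / 2 + ln (l F) + ln (1 + x F)"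
        using w1 elim by (simp add: ln_mult ln_sqrt)
      then have "y F = ln (l F) - ln (norm q) - ln (cusp_height (w F))"
        using q w1 by (simp add: y_def v_def f2_def q_def[symmetric])
      also have "\<dots> = ln (l F / (norm q * cusp_height (w F)))"
        using q elim by (simp add: ln_div ln_mult)
      finally have "exp (y F) = l F / (norm q * cusp_height (w F))"
        using q elim by simp
      moreover have "\<bar>ln (norm F)\<bar> = l F" using elim by (simp add: l_def)
      ultimately have "exp (y F) = G F" by (simp add: G_def q_def)
      then show ?case by simp
    qed
  qed
  ultimately have "(\<lambda>F. G F - norm (1 - Y F)) \<in> O[at 0](?Q)" by (simp add: landau_o.big.in_cong)
  then show "(\<lambda>F. \<bar>ln (norm F)\<bar> / (norm (1 + 16 * t * F) * cusp_height (w F))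
        - norm (1 - 8 * (c * F - of_real (Re (c * F) / ln (norm F))))) \<in> O[at 0](?Q)"
    by (simp add: G_def Y_def)
qed

theorem corollary8p9:
  fixes a1 a2 a3 :: complex and p :: "complex \<Rightarrow> cp1"
  assumes "a1 \<noteq> a2" and "a1 \<noteq> a3" and "a2 \<noteq> a3"
    and "holomorphic_universal_covering p (- {affine_point a1, affine_point a2, affine_point a3})"
  shows "\<exists>E :: complex \<Rightarrow> complex.
    E \<in> O[at a1](\<lambda>f. (cusp_coord a1 a2 a3 f)\<^sup>2) \<and>
    (\<forall>\<^sub>F f in at a1. \<forall>df :: complex.
      (let F = cusp_coord a1 a2 a3 f; c = 2 * ((a2 - a1) / (a2 - a3)) - 1 in
       KE_length p f df =
         norm (a2 - a3) / (16 * norm (a1 - a3) * norm (a2 - a1))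
         * (1 / (norm F * \<bar>ln (norm F)\<bar>))
         * norm (1 - 8 * (c * F - complex_of_real (Re (c * F) / ln (norm F))) + E f)
         * norm df))"
proof -
  define t where "t = (a2 - a1) / (a2 - a3)"
  define c where "c = 2 * t - 1"
  define w where "w = (\<lambda>F. 16 * F / (1 + 16 * t * F))"
  define X where "X = (\<lambda>F. 8 * (c * F - of_real (Re (c * F) / ln (norm F))))"
  define G where "G = (\<lambda>F. \<bar>ln (norm F)\<bar> / (norm (1 + 16 * t * F) * cusp_height (w F)))"
  \<comment> \<open>Only the modulus of 1 - X + E is prescribed, so \<open>E\<close> is taken
    collinear with 1 - \<open>X F\<close>. This gives it the least possible size |G - |1 - X||; the
    case X F = 1, where no direction is defined, is separate.\<close>
  define E where "E = (\<lambda>F. if X F = 1 then of_real (G F)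
    else (1 - X F) * of_real (G F / norm (1 - X F) - 1) :: complex)"
  define k where "k = (a2 - a3) / (16 * (a1 - a3) * (a2 - a1))"
  have d: "a2 - a1 \<noteq> 0" "a2 - a3 \<noteq> 0" "a1 - a3 \<noteq> 0" using assms by auto
  have k: "k \<noteq> 0" using d by (simp add: k_def)
  have coord: "cusp_coord a1 a2 a3 f = k * (f - a1)" for f by (simp add: cusp_coord_def k_def)
  have lim: "filterlim (cusp_coord a1 a2 a3) (at 0) (at a1)"
    unfolding filterlim_at coord using k by (auto intro!: tendsto_eq_intros simp: eventually_at_filter)
  have normE: "norm (E F) = \<bar>G F - norm (1 - X F)\<bar>" and norm1: "norm (1 - X F + E F) = \<bar>G F\<bar>" for F
  proof -
    show "norm (E F) = \<bar>G F - norm (1 - X F)\<bar>"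
    proof (cases "X F = 1")
      case False
      then have n: "norm (1 - X F) > 0" by simp
      have "norm (E F) = norm (1 - X F) * \<bar>G F / norm (1 - X F) - 1\<bar>"
        using False by (simp only: E_def if_False norm_mult norm_of_real)
      also have "\<dots> = \<bar>norm (1 - X F) * (G F / norm (1 - X F) - 1)\<bar>" by (simp add: abs_mult)
      also have "norm (1 - X F) * (G F / norm (1 - X F) - 1) = G F - norm (1 - X F)"
        using n by (simp add: right_diff_distrib)
      finally show ?thesis .
    qed (simp add: E_def)
    show "norm (1 - X F + E F) = \<bar>G F\<bar>"
    proof (cases "X F = 1")
      case False
      then have "1 - X F + E F = (1 - X F) * of_real (G F / norm (1 - X F))"
        by (simp add: E_def algebra_simps)
      then show ?thesis using False by (simp add: norm_mult norm_divide)
    qed (simp add: E_def)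
  qed
  have "(\<lambda>F. G F - norm (1 - X F)) \<in> O[at 0](\<lambda>F. (norm F)\<^sup>2)"
    using cusp_density_expansion(2)[of t] by (simp add: G_def X_def w_def c_def)
  then have "(\<lambda>F. norm (E F)) \<in> O[at 0](\<lambda>F. norm (F\<^sup>2))"
    by (simp add: normE norm_power)
  then have "E \<in> O[at 0](\<lambda>F. F\<^sup>2)" by simp
  from landau_o.big.compose[OF this lim]
  have bigo: "(\<lambda>f. E (cusp_coord a1 a2 a3 f)) \<in> O[at a1](\<lambda>f. (cusp_coord a1 a2 a3 f)\<^sup>2)" .
  have "eventually (\<lambda>F. 0 < cusp_height (w F)) (at 0)"
    using cusp_density_expansion(1)[of t] by (simp add: w_def)
  \<comment> \<open>Inside the punctured unit disc ln |F| is nonzero, so it cancels between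
    \<open>G\<close> and the prefactor.\<close>
  moreover have "eventually (\<lambda>F :: complex. F \<in> ball 0 1 - {0}) (at 0)"
    by (intro eventually_at_in_open) auto
  ultimately have "eventually (\<lambda>F. 0 < cusp_height (w F) \<and> norm F < 1 \<and> F \<noteq> 0) (at 0)"
    by eventually_elim auto
  with lim have "eventually (\<lambda>f. let F = cusp_coord a1 a2 a3 f in
      0 < cusp_height (w F) \<and> norm F < 1 \<and> F \<noteq> 0) (at a1)"
    unfolding filterlim_iff Let_def by blast
  moreover have "eventually (\<lambda>f. f \<in> - {a2, a3} - {a1}) (at a1)"
    using assms by (intro eventually_at_in_open) auto
  ultimately have "\<forall>\<^sub>F f in at a1. \<forall>df :: complex.
      KE_length p f df = norm k * (1 / (norm (cusp_coord a1 a2 a3 f) * \<bar>ln (norm (cusp_coord a1 a2 a3 f))\<bar>))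
         * norm (1 - X (cusp_coord a1 a2 a3 f) + E (cusp_coord a1 a2 a3 f)) * norm df"
  proof eventually_elim
    case (elim f)
    define F where "F = cusp_coord a1 a2 a3 f"
    have F: "0 < cusp_height (w F)" "norm F < 1" "F \<noteq> 0" using elim(1) by (simp_all add: F_def Let_def)
    have f: "f \<noteq> a1" "f \<noteq> a2" "f \<noteq> a3" "f - a1 \<noteq> 0" "f - a3 \<noteq> 0" using elim(2) by auto
    have "16 * (u / v) * (v / (16 * s * u)) = 1 / s" if "u \<noteq> 0" "v \<noteq> 0" for u v s :: complex
      using that by simp
    from this[OF d(1,2)] have "16 * t * k = 1 / (a1 - a3)" by (simp only: t_def k_def)
    then have "16 * t * F = (f - a1) / (a1 - a3)"
      by (simp add: F_def coord mult.assoc[symmetric])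
    \<comment> \<open>Thus 1 + 16 t F vanishes exactly at the cusp \<open>a3\<close>, and 16 F / (1
      + 16 t F) is the Moebius coordinate.\<close>
    then have q: "1 + 16 * t * F = (f - a3) / (a1 - a3)" using d by (simp add: field_simps)
    have wF: "w F = (f - a1) * (a2 - a3) / ((f - a3) * (a2 - a1))"
    proof -
      have "16 * (v / (16 * s * u) * x) / (y / s) = x * v / (y * u)"
        if "s \<noteq> 0" for s u v x y :: complex
        using that by (simp add: mult.commute)
      note this[OF d(3)]
      moreover have "w F = 16 * F / ((f - a3) / (a1 - a3))" by (simp only: w_def q)
      ultimately show ?thesis by (simp only: F_def coord k_def)
    qed
    \<comment> \<open>The logarithmic derivative from \<open>KE_length_eq\<close>, rewritten in F;
      its numerator \<open>k\<close> is the prefactor of the theorem.\<close>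
    have "(a1 - a3) / ((f - a1) * (f - a3)) = k / (F * (1 + 16 * t * F))"
      unfolding q using d f k by (simp add: F_def coord)
    then have "KE_length p f df = norm k / (norm F * norm (1 + 16 * t * F)) / cusp_height (w F) * norm df" for df
      using KE_length_eq[OF assms f(1-3) wF F(1), of df] by (simp add: norm_divide norm_mult)
    moreover have "\<bar>G F\<bar> = \<bar>ln (norm F)\<bar> / (norm (1 + 16 * t * F) * cusp_height (w F))"
      using F(1) by (simp add: G_def abs_mult)
    moreover have "ln (norm F) \<noteq> 0" using F by simp
    ultimately show ?case by (simp add: norm1 F_def[symmetric])
  qed
  moreover have "norm (a2 - a3) / (16 * norm (a1 - a3) * norm (a2 - a1)) = norm k"
    by (simp only: k_def norm_divide norm_mult norm_numeral)
  ultimately show ?thesis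
    using bigo
    by (intro exI[of _ "\<lambda>f. E (cusp_coord a1 a2 a3 f)"])
       (simp add: Let_def X_def c_def t_def)
qed

end
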